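(* Let $X(t):=L(\Theta(t))=(L_1(\Theta_1(t)),\dots,L_d(\Theta_d(t)))$, $t\ge 0$, be the multivariate subordinated process. Then $X$ is a Lévy process and its Lévy exponent is given by $$\rho:H\to\mathbb C,\qquad u\mapsto\psi\big(\varphi_1(u_1),\dots,\varphi_d(u_d)\big).$$
   Context: Setting. $d\in\mathbb N$; for $j=1,\dots,d$, $(H_j,\langle\cdot|\cdot\rangle_j)$ is a separable (real) Hilbert space and $L_j$ is an $H_j$-valued càdlàg Lévy process; $L_1,\dots,L_d$ are independent. The Lévy exponent of $L_j$ is the function $\varphi_j:H_j\to\mathbb C$ with $\mathrm{E}e^{i\langle L_j(t)|u\rangle_j}=\exp(t\varphi_j(u))$ for all $t\ge0$, $u\in H_j$; Lévy exponents of other Hilbert space valued Lévy processes are defined in the same way. $H:=H_1\times\dots\times H_d$ with inner product $\langle u|v\rangle=\sum_{j=1}^d\langle u_j|v_j\rangle_j$; $L=(L_1,\dots,L_d)$; for $\theta\in\mathbb R_+^d$, $L(\theta):=(L_1(\theta_1),\dots,L_d(\theta_d))$. $\Theta=(\Theta_1,\dots,\Theta_d)$ is an $\mathbb R^d$-valued càdlàg Lévy process such that each $\Theta_j$ is a subordinator (nondecreasing real Lévy process). Its Lévy–Khintchine triplet with respect to the truncation function $\chi(x)=x1_{\{|x|\le1\}}$ is $(a,0,F)$; $F$ is concentrated on $\mathbb R_+^d$ and $a_0:=a-\int_{\mathbb R_+^d}\chi(\theta)F(d\theta)\in\mathbb R_+^d$. With $\mathbb R_-=(-\infty,0]$, $\psi:(\mathbb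 R_-+i\mathbb R)^d\to\mathbb C$ is defined by $\psi(s)=\sum_j a_{0,j}s_j+\int_{\mathbb R_+^d}(e^{\sum_j s_j\theta_j}-1)F(d\theta)$, so that $\mathrm{E}e^{\sum_j s_j\Theta_j(1)}=e^{\psi(s)}$.
   Formalization: Independence of L and Θ is assumed explicitly; without it the claim fails (L=N Poisson, Θ(t)=t+N(t)). The spaces H_j are taken, up to isometry, as closed subspaces of one separable Hilbert space, and subordinator paths are nonnegative and nondecreasing everywhere. *)

theory Defs
  imports "HOL-Probability.Probability"
begin

instance vec :: ("{metric_space,second_countable_topology}", finite) second_countable_topology
proof
  obtain A :: "'a set set" where A: "countable A" "topological_basis A"
    using ex_countable_basis by auto
  define B :: "('a ^ 'b) set set"
    where "B = (\<lambda>f. {x. \<forall>i. x $ i \<in> f i}) ` (PiE UNIV (\<lambda>_. A))"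
  have "countable B"
    unfolding B_def by (intro countable_image countable_PiE) (use A in auto)
  moreover have "topological_basis B"
  proof (rule topological_basisI)
    fix U assume "U \<in> B"
    then show "open U"
      unfolding B_def using topological_basis_open[OF A(2)]
      by (auto simp: PiE_iff intro!: open_vector_box)
  next
    fix S :: "('a ^ 'b) set" and x assume "open S" "x \<in> S"
    then obtain f where f: "\<And>i. open (f i)" "\<And>i. x $ i \<in> f i"
      "\<And>y. (\<forall>i. y $ i \<in> f i) \<Longrightarrow> y \<in> S"
      unfolding open_vec_def by metis
    have "\<exists>C\<in>A. x $ i \<in> C \<and> C \<subseteq> f i" for i
      using topological_basisE[OF A(2) f(1,2)] by metis
    then obtain g where "\<And>i. g i \<in> A \<and> x $ i \<in> g i \<and> g i \<subseteq> f i"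
      by metis
    then show "\<exists>U\<in>B. x \<in> U \<and> U \<subseteq> S"
      unfolding B_def using f(3)
      by (intro bexI[where x = "{y. \<forall>i. y $ i \<in> g i}"]) (auto simp: PiE_iff, blast)
  qed
  ultimately show "\<exists>B :: ('a ^ 'b) set set. countable B \<and> open = generate_topology B"
    using topological_basis_imp_subbasis by metis
qed

instance vec :: (polish_space, finite) polish_space ..

text \<open>Processes are indexed by real, but only the times \<open>t \<ge> 0\<close> matter. The Hilbert space in
  which a process lives is a closed subspace \<open>S\<close> of a separable Hilbert space type. In this way
  finitely many different separable Hilbert spaces can be treated as subspaces of one type (for
  example of their direct sum).
  Regularity of paths is not part of \<open>levy_process\<close>; it is added by \<open>cadlag\<close> (for every path).\<close>

definition levy_process ::
  "'w measure \<Rightarrow> 'a::{real_inner,polish_space} set \<Rightarrow> (real \<Rightarrow> 'w \<Rightarrow> 'a) \<Rightarrow> bool"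
  where "levy_process M S X \<longleftrightarrow>
    (\<forall>t\<ge>0. X t \<in> borel_measurable M) \<and>
    (\<forall>t\<ge>0. \<forall>\<omega>\<in>space M. X t \<omega> \<in> S) \<and>
    (AE \<omega> in M. X 0 \<omega> = 0) \<and>
    (\<forall>(n::nat) t. 0 \<le> t 0 \<and> (\<forall>i<n. t i \<le> t (Suc i)) \<longrightarrow>
      prob_space.indep_vars M (\<lambda>_. borel) (\<lambda>i \<omega>. X (t (Suc i)) \<omega> - X (t i) \<omega>) {..<n}) \<and>
    (\<forall>s\<ge>0. \<forall>t\<ge>0. distr M borel (\<lambda>\<omega>. X (s + t) \<omega> - X s \<omega>)
                 = distr M borel (\<lambda>\<omega>. X t \<omega> - X 0 \<omega>)) \<and>
    (\<forall>t\<ge>0. \<forall>\<epsilon>>0. ((\<lambda>s. measure M {\<omega> \<in> space M. norm (X s \<omega> - X t \<omega>) > \<epsilon>}) \<longlongrightarrow> 0)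
                     (at t within {0..}))"

definition cadlag :: "'w measure \<Rightarrow> (real \<Rightarrow> 'w \<Rightarrow> 'a::topological_space) \<Rightarrow> bool"
  where "cadlag M X \<longleftrightarrow> (\<forall>\<omega>\<in>space M.
    (\<forall>t\<ge>0. ((\<lambda>s. X s \<omega>) \<longlongrightarrow> X t \<omega>) (at_right t)) \<and>
    (\<forall>t>0. \<exists>l. ((\<lambda>s. X s \<omega>) \<longlongrightarrow> l) (at_left t)))"

text \<open>Nonnegativity is required for every path, because the values of a subordinator are used as
  times while \<open>levy_process\<close> fixes the value at time 0 only almost surely.\<close>

definition subordinator :: "'w measure \<Rightarrow> (real \<Rightarrow> 'w \<Rightarrow> real) \<Rightarrow> bool"
  where "subordinator M Y \<longleftrightarrow> levy_process M UNIV Y \<and>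
    (\<forall>\<omega>\<in>space M. (\<forall>t\<ge>0. 0 \<le> Y t \<omega>) \<and> (\<forall>s\<ge>0. \<forall>t\<ge>s. Y s \<omega> \<le> Y t \<omega>))"

text \<open>The values of \<open>\<phi>\<close> on \<open>S\<close> are uniquely determined; those outside \<open>S\<close> are irrelevant.\<close>

definition has_levy_exponent ::
  "'w measure \<Rightarrow> 'a::{real_inner,polish_space} set \<Rightarrow> (real \<Rightarrow> 'w \<Rightarrow> 'a) \<Rightarrow> ('a \<Rightarrow> complex) \<Rightarrow> bool"
  where "has_levy_exponent M S X \<phi> \<longleftrightarrow>
    (\<forall>t\<ge>0. \<forall>u\<in>S. (LINT \<omega>|M. iexp (inner (X t \<omega>) u)) = exp (of_real t * \<phi> u))"

text \<open>The inner product of the vector type is the sum of the componentwise inner products.\<close>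

definition hilbert_prod :: "('d \<Rightarrow> 'h set) \<Rightarrow> ('h ^ 'd) set"
  where "hilbert_prod H = {u. \<forall>j. u $ j \<in> H j}"

definition nonneg_orthant :: "(real ^ 'd) set"
  where "nonneg_orthant = {\<theta>. \<forall>j. 0 \<le> \<theta> $ j}"

definition trajectory :: "(real \<Rightarrow> 'w \<Rightarrow> 'a) \<Rightarrow> 'w \<Rightarrow> real \<Rightarrow> 'a"
  where "trajectory X \<omega> = (\<lambda>t\<in>{0..}. X t \<omega>)"

abbreviation trajectory_space :: "(real \<Rightarrow> 'a::topological_space) measure"
  where "trajectory_space \<equiv> PiM {0..} (\<lambda>_. borel)"

definition process_algebra :: "'w measure \<Rightarrow> (real \<Rightarrow> 'w \<Rightarrow> 'a::topological_space) \<Rightarrow> 'w measure"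
  where "process_algebra M X = vimage_algebra (space M) (trajectory X) trajectory_space"

text \<open>The library's \<open>indep_var\<close> compares only random variables of equal type, so that independence
  of two processes with different state spaces is expressed by the generated sigma-algebras.\<close>

definition (in prob_space) indep_processes ::
  "(real \<Rightarrow> 'a \<Rightarrow> 'b::topological_space) \<Rightarrow> (real \<Rightarrow> 'a \<Rightarrow> 'c::topological_space) \<Rightarrow> bool"
  where "indep_processes X Y \<longleftrightarrow>
    indep_set (sets (process_algebra M X)) (sets (process_algebra M Y))"

definition trunc :: "real ^ 'd \<Rightarrow> real ^ 'd"
  where "trunc x = (if norm x \<le> 1 then x else 0)"

definition levy_measure :: "(real ^ 'd) measure \<Rightarrow> bool"
  where "levy_measure F \<longleftrightarrow> sets F = sets borel \<and> emeasure F {0} = 0 \<and>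
    (\<integral>\<^sup>+x. ennreal (min 1 ((norm x)\<^sup>2)) \<partial>F) < \<infinity>"

definition has_levy_khintchine_triplet ::
  "'w measure \<Rightarrow> (real \<Rightarrow> 'w \<Rightarrow> real ^ 'd) \<Rightarrow> real ^ 'd \<Rightarrow> real ^ 'd ^ 'd \<Rightarrow> (real ^ 'd) measure \<Rightarrow> bool"
  where "has_levy_khintchine_triplet M X a Q F \<longleftrightarrow>
    transpose Q = Q \<and> (\<forall>x. 0 \<le> inner x (Q *v x)) \<and> levy_measure F \<and>
    has_levy_exponent M UNIV X (\<lambda>u. \<i> * of_real (inner a u) - of_real (inner u (Q *v u)) / 2
      + (LINT x|F. (iexp (inner x u) - 1 - \<i> * of_real (inner (trunc x) u))))"

definition drift0 :: "real ^ 'd \<Rightarrow> (real ^ 'd) measure \<Rightarrow> real ^ 'd"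
  where "drift0 a F = a - (LINT \<theta>:nonneg_orthant|F. trunc \<theta>)"

text \<open>The relevant domain consists of the \<open>s\<close> whose components all have nonpositive real part.\<close>

definition subordinator_exponent ::
  "real ^ 'd \<Rightarrow> (real ^ 'd) measure \<Rightarrow> complex ^ 'd \<Rightarrow> complex"
  where "subordinator_exponent a F s =
    (\<Sum>j\<in>UNIV. of_real (drift0 a F $ j) * s $ j) +
    (LINT \<theta>:nonneg_orthant|F. (exp (\<Sum>j\<in>UNIV. s $ j * of_real (\<theta> $ j)) - 1))"

definition multi_eval :: "('d \<Rightarrow> real \<Rightarrow> 'w \<Rightarrow> 'h) \<Rightarrow> real ^ 'd \<Rightarrow> 'w \<Rightarrow> 'h ^ 'd"
  where "multi_eval L \<theta> \<omega> = (\<chi> j. L j (\<theta> $ j) \<omega>)"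

end

theory Submission
  imports Defs "HOL-Complex_Analysis.Conformal_Mappings"
begin

text \<open>
  The idea is to condition on the time change. For a fixed value \<open>\<theta>\<close> of the times,
  the vector \<open>(L\<^sub>1(\<theta>\<^sub>1), \<dots>, L\<^sub>d(\<theta>\<^sub>d))\<close> is a process with independent increments
  along componentwise increasing chains of \<open>\<theta>\<close>'s, and the law of an increment depends only on
  the difference of the times: independence across components and independence over time
  combine into independence of a whole grid of increments. Because \<open>\<Theta>\<close> is independent of \<open>L\<close>
  and has nondecreasing components, Fubini's theorem on the product of the two generated
  sigma-algebras (\<open>freezing\<close>) allows the times \<open>\<Theta>(t\<^sub>i)\<close> to be treated as constants while \<open>L\<close> is
  integrated out. With \<open>K g \<theta> = E g(L(\<theta>) - L(0))\<close> this gives the single identity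
  \<open>E (\<Prod>i. g\<^sub>i(X(t\<^sub>i\<^sub>+\<^sub>1) - X(t\<^sub>i))) = E (\<Prod>i. K g\<^sub>i (\<Theta>(t\<^sub>i\<^sub>+\<^sub>1) - \<Theta>(t\<^sub>i)))\<close>
  (\<open>expectation_prod_increments\<close>), from which everything probabilistic follows. For indicator
  functions \<open>g\<^sub>i\<close> the independence and stationarity of the increments of \<open>\<Theta>\<close> carry over to \<open>X\<close>.
  For \<open>g x = exp (i\<langle>x|u\<rangle>)\<close> it gives
  \<open>E exp (i\<langle>X(t)|u\<rangle>) = E exp (\<Sum>j. \<phi>\<^sub>j(u\<^sub>j) \<Theta>\<^sub>j(t))\<close>.

  The paths of \<open>X\<close> are cadlag since a cadlag function composed with a nondecreasing cadlag function
  is cadlag, and right continuity at 0 together with stationarity yields continuity in probability.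

  What remains is analytic: the triplet determines the characteristic function of \<open>\<Theta>(t)\<close>,
  whereas the right-hand side above is its Laplace transform at the complex point
  \<open>s = (\<phi>\<^sub>1(u\<^sub>1), \<dots>, \<phi>\<^sub>d(u\<^sub>d))\<close>, whose components have nonpositive real part. Both
  \<open>s \<mapsto> E exp (s \<bullet> \<Theta>(t))\<close> and \<open>s \<mapsto> exp (t \<psi>(s))\<close> are, in each variable separately, continuous on the
  closed left half plane and holomorphic inside. They agree when all \<open>s\<^sub>j\<close> are imaginary, and
  a function of this kind that vanishes on the imaginary axis vanishes on the half plane
  (\<open>zero_on_left_half_plane\<close>); moving one coordinate after the other off the imaginary axis
  (\<open>laplace_transform_of_characteristic_function\<close>) shows that they agree everywhere.
\<close>

section \<open>Holomorphic dependence of integrals on a parameter\<close>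

text \<open>Cauchy's inequality turns the local bound on the integrand into a bound on its derivative, and
  the mean value inequality then dominates the difference quotients, so that the limit may be taken
  under the integral sign.\<close>

lemma holomorphic_on_LINT:
  fixes f :: "complex \<Rightarrow> 'x \<Rightarrow> complex"
  assumes S: "open S"
    and meas: "\<And>z. z \<in> S \<Longrightarrow> f z \<in> borel_measurable N"
    and hol: "\<And>x. x \<in> space N \<Longrightarrow> (\<lambda>z. f z x) holomorphic_on S"
    and dom: "\<And>z. z \<in> S \<Longrightarrow> \<exists>g r. r > 0 \<and> integrable N g \<and>
                (\<forall>w\<in>S \<inter> ball z r. \<forall>x\<in>space N. norm (f w x) \<le> g x)"
  shows "(\<lambda>z. LINT x|N. f z x) holomorphic_on S"
  unfolding holomorphic_on_open[OF S]
proof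
  fix z assume z: "z \<in> S"
  obtain g r0 where r0: "r0 > 0" and g: "integrable N g"
    and le_g: "\<And>w x. w \<in> S \<inter> ball z r0 \<Longrightarrow> x \<in> space N \<Longrightarrow> norm (f w x) \<le> g x"
    using dom[OF z] by metis
  have "open (S \<inter> ball z r0)" "z \<in> S \<inter> ball z r0"
    using S z r0 by auto
  then obtain e where e: "e > 0" "cball z e \<subseteq> S \<inter> ball z r0"
    unfolding open_contains_cball by blast
  define r where "r = e / 2"
  have r: "r > 0" using e by (simp add: r_def)
  have sub: "cball w r \<subseteq> S \<inter> ball z r0" if "w \<in> ball z r" for w
  proof -
    have "cball w r \<subseteq> cball z e"
      using that by (simp add: cball_subset_cball_iff r_def dist_commute)
    with e show ?thesis by blast
  qed
  have "w \<in> cball w r" for w :: complex using r by simp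
  then have ball_S: "ball z r \<subseteq> S"
    using sub by blast
  define D where "D w x = deriv (\<lambda>w. f w x) w" for w x
  have deriv: "((\<lambda>w. f w x) has_field_derivative D w x) (at w)"
    if "x \<in> space N" "w \<in> ball z r" for x w
    using holomorphic_derivI[OF hol S] that ball_S by (auto simp: D_def)
  have D_le: "norm (D w x) \<le> g x / r" if x: "x \<in> space N" and w: "w \<in> ball z r" for x w
  proof -
    have "norm ((deriv ^^ 1) (\<lambda>w. f w x) w) \<le> fact 1 * g x / r ^ 1"
    proof (rule Cauchy_inequality)
      show "(\<lambda>w. f w x) holomorphic_on ball w r"
        using sub[OF w] ball_subset_cball by (intro holomorphic_on_subset[OF hol[OF x]]) blast
      show "continuous_on (cball w r) (\<lambda>w. f w x)"
        using sub[OF w]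
        by (intro holomorphic_on_imp_continuous_on holomorphic_on_subset[OF hol[OF x]]) blast
      show "norm (f y x) \<le> g x" if "norm (w - y) = r" for y
        using sub[OF w] that x by (intro le_g) (auto simp: dist_norm subset_iff)
    qed (use r in auto)
    then show ?thesis by (simp add: D_def)
  qed
  have quot: "norm ((f w x - f z x) / (w - z)) \<le> g x / r"
    if x: "x \<in> space N" and w: "w \<in> ball z r" "w \<noteq> z" for x w
  proof -
    have "norm (f w x - f z x) \<le> g x / r * norm (w - z)"
      by (rule field_differentiable_bound[of "ball z r" "\<lambda>w. f w x" "\<lambda>w. D w x"])
         (use r w x in \<open>auto intro!: has_field_derivative_at_within[OF deriv] D_le\<close>)
    with w show ?thesis
      by (simp add: norm_divide divide_le_eq)
  qed
  have int_f: "integrable N (f w)" if "w \<in> ball z r" for w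
  proof (rule Bochner_Integration.integrable_bound[OF g])
    show "f w \<in> borel_measurable N" using meas ball_S that by blast
    show "AE x in N. norm (f w x) \<le> norm (g x)"
      using sub[OF that] r by (intro AE_I2 order_trans[OF le_g] abs_ge_self) (auto simp: subset_iff)
  qed
  have "((\<lambda>w. ((LINT x|N. f w x) - (LINT x|N. f z x)) / (w - z)) \<longlongrightarrow> (LINT x|N. D z x)) (at z)"
    unfolding tendsto_at_iff_sequentially comp_def
  proof safe
    fix X :: "nat \<Rightarrow> complex" assume X: "\<forall>i. X i \<in> UNIV - {z}" "X \<longlonglongrightarrow> z"
    have "\<forall>\<^sub>F i in sequentially. X i \<in> ball z r"
      using X(2) r by (intro topological_tendstoD) auto
    then obtain n where n: "\<And>i. i \<ge> n \<Longrightarrow> X i \<in> ball z r"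
      unfolding eventually_sequentially by blast
    define Y where "Y i = X (i + n)" for i
    have Y: "Y i \<in> ball z r" "Y i \<noteq> z" for i
      using n X(1) by (auto simp: Y_def)
    have Y_lim: "Y \<longlonglongrightarrow> z"
      using X(2) unfolding Y_def by (rule LIMSEQ_ignore_initial_segment)
    have z_ball: "z \<in> ball z r" using r by simp
    have pointwise: "(\<lambda>i. (f (Y i) x - f z x) / (Y i - z)) \<longlonglongrightarrow> D z x" if x: "x \<in> space N" for x
      using deriv[OF x z_ball] Y Y_lim
      unfolding has_field_derivative_iff tendsto_at_iff_sequentially comp_def by blast
    have quot_meas: "(\<lambda>x. (f (Y i) x - f z x) / (Y i - z)) \<in> borel_measurable N" for i
      using meas[of "Y i"] meas[OF z] ball_S Y(1)[of i]
      by (intro borel_measurable_divide borel_measurable_diff) auto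
    have "(\<lambda>i. LINT x|N. (f (Y i) x - f z x) / (Y i - z)) \<longlonglongrightarrow> (LINT x|N. D z x)"
    proof (rule integral_dominated_convergence)
      show "D z \<in> borel_measurable N"
        by (rule borel_measurable_LIMSEQ_metric[OF quot_meas pointwise])
      show "integrable N (\<lambda>x. g x / r)" using g by simp
    qed (use quot_meas pointwise quot Y in auto)
    moreover have "(LINT x|N. (f (Y i) x - f z x) / (Y i - z)) =
        ((LINT x|N. f (Y i) x) - (LINT x|N. f z x)) / (Y i - z)" for i
      using int_f[OF Y(1)] int_f[OF z_ball] by simp
    ultimately have "(\<lambda>i. ((LINT x|N. f (Y i) x) - (LINT x|N. f z x)) / (Y i - z))
        \<longlonglongrightarrow> (LINT x|N. D z x)"
      by (simp only:)
    then show "(\<lambda>i. ((LINT x|N. f (X i) x) - (LINT x|N. f z x)) / (X i - z))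
        \<longlonglongrightarrow> (LINT x|N. D z x)"
      unfolding Y_def by (rule LIMSEQ_offset)
  qed
  then show "\<exists>f'. ((\<lambda>z. LINT x|N. f z x) has_field_derivative f') (at z)"
    unfolding has_field_derivative_iff by blast
qed

lemma continuous_on_LINT_dominated:
  fixes f :: "complex \<Rightarrow> 'x \<Rightarrow> complex"
  assumes meas: "\<And>z. z \<in> S \<Longrightarrow> f z \<in> borel_measurable N"
    and cont: "\<And>x. x \<in> space N \<Longrightarrow> continuous_on S (\<lambda>z. f z x)"
    and dom: "\<And>z. z \<in> S \<Longrightarrow> \<exists>g r. r > 0 \<and> integrable N g \<and>
                (\<forall>w\<in>S \<inter> ball z r. \<forall>x\<in>space N. norm (f w x) \<le> g x)"
  shows "continuous_on S (\<lambda>z. LINT x|N. f z x)"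
  unfolding continuous_on_sequentially comp_def
proof safe
  fix X z assume X: "\<forall>i. X i \<in> S" "X \<longlonglongrightarrow> z" and z: "z \<in> S"
  obtain g r where r: "r > 0" and g: "integrable N g"
    and le_g: "\<And>w x. w \<in> S \<inter> ball z r \<Longrightarrow> x \<in> space N \<Longrightarrow> norm (f w x) \<le> g x"
    using dom[OF z] by metis
  have "\<forall>\<^sub>F i in sequentially. X i \<in> ball z r"
    using X(2) r by (intro topological_tendstoD) auto
  then obtain n where n: "\<And>i. i \<ge> n \<Longrightarrow> X i \<in> ball z r"
    unfolding eventually_sequentially by blast
  have Y_lim: "(\<lambda>i. X (i + n)) \<longlonglongrightarrow> z"
    using X(2) by (rule LIMSEQ_ignore_initial_segment)
  have "(\<lambda>i. LINT x|N. f (X (i + n)) x) \<longlonglongrightarrow> (LINT x|N. f z x)"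
  proof (rule integral_dominated_convergence[OF meas[OF z] meas g])
    show "AE x in N. (\<lambda>i. f (X (i + n)) x) \<longlonglongrightarrow> f z x"
      using cont X(1) z Y_lim unfolding continuous_on_sequentially comp_def by (intro AE_I2) auto
    show "AE x in N. norm (f (X (i + n)) x) \<le> g x" for i
      using X(1) n[of "i + n"] by (intro AE_I2 le_g) auto
  qed (use X in auto)
  then show "(\<lambda>i. LINT x|N. f (X i) x) \<longlonglongrightarrow> (LINT x|N. f z x)"
    by (rule LIMSEQ_offset)
qed

text \<open>Extended by zero to the right half plane, \<open>h\<close> is continuous everywhere and holomorphic off a
  line, hence entire, and it vanishes on an open set.\<close>

lemma zero_on_left_half_plane:
  fixes h :: "complex \<Rightarrow> complex"
  assumes cont: "continuous_on {z. Re z \<le> 0} h"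
    and hol: "h holomorphic_on {z. Re z < 0}"
    and zero: "\<And>z. Re z = 0 \<Longrightarrow> h z = 0"
    and z: "Re z \<le> 0"
  shows "h z = 0"
proof -
  define k where "k w = (if Re w \<le> 0 then h w else 0)" for w
  have "continuous_on ({w. Re w \<le> 0} \<union> {w. 0 \<le> Re w}) k"
    unfolding k_def
  proof (rule continuous_on_If)
    show "closed {w. Re w \<le> 0}" by (intro closed_Collect_le continuous_intros)
    show "closed {w. 0 \<le> Re w}" by (intro closed_Collect_le continuous_intros)
  qed (use cont zero in auto)
  moreover have "{w. Re w \<le> 0} \<union> {w. 0 \<le> Re w} = UNIV" by auto
  ultimately have k_cont: "continuous_on UNIV k" by simp
  have "k holomorphic_on UNIV"
  proof (rule holomorphic_on_paste_across_line[where d = 1 and k = 0])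
    have "k holomorphic_on {w. Re w < 0}"
      using hol by (rule holomorphic_transform) (simp add: k_def)
    then show "k holomorphic_on UNIV \<inter> {z. inner 1 z < 0}" by simp
    have "(\<lambda>_. 0) holomorphic_on {w. 0 < Re w}" by simp
    then have "k holomorphic_on {w. 0 < Re w}"
      by (rule holomorphic_transform) (simp add: k_def)
    then show "k holomorphic_on UNIV \<inter> {z. 0 < inner 1 z}" by simp
  qed (use k_cont in auto)
  then have "k z = 0"
  proof (rule analytic_continuation_open[of "{w. 0 < Re w}" UNIV k "\<lambda>_. 0", rotated 5])
    show "open {w. 0 < Re w}" by (intro open_Collect_less continuous_intros)
    show "{w. 0 < Re w} \<noteq> {}" by (auto intro: exI[of _ 1])
  qed (auto simp: k_def)
  with z show ?thesis by (simp add: k_def)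
qed

lemma norm_exp_minus_one_le:
  fixes w :: complex
  assumes "Re w \<le> 0"
  shows "norm (exp w - 1) \<le> norm w"
proof -
  have "norm (exp w - exp 0) \<le> 1 * norm (w - 0)"
  proof (rule field_differentiable_bound[of "{w. Re w \<le> 0}" exp exp])
    show "convex {w. Re w \<le> 0}" by (rule convex_halfspace_Re_le)
  qed (use assms in \<open>auto intro: DERIV_exp has_field_derivative_at_within\<close>)
  then show ?thesis by simp
qed

section \<open>From characteristic functions to Laplace transforms on the orthant\<close>

text \<open>The coordinatewise substitution by which a function of several complex variables is studied in
  one variable at a time.\<close>

definition replace_coord :: "'a ^ 'd \<Rightarrow> 'd \<Rightarrow> 'a \<Rightarrow> 'a ^ 'd"
  where "replace_coord s j z = (\<chi> k. if k = j then z else s $ k)"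

lemma replace_coord_nth [simp]: "replace_coord s j z $ k = (if k = j then z else s $ k)"
  by (simp add: replace_coord_def)

lemma holomorphic_on_replace_coord [holomorphic_intros]:
  "(\<lambda>z. replace_coord s j z $ k) holomorphic_on A"
  by (cases "k = j") auto

lemma nonneg_orthant_sets [measurable]: "nonneg_orthant \<in> sets (borel :: (real ^ 'd) measure)"
proof -
  have "closed (nonneg_orthant :: (real ^ 'd) set)"
    unfolding nonneg_orthant_def by (intro closed_Collect_all closed_Collect_le continuous_intros)
  then show ?thesis by simp
qed

lemma Re_linear_nonpos:
  fixes s :: "complex ^ 'd" and x :: "real ^ 'd"
  assumes "\<And>k. Re (s $ k) \<le> 0" "x \<in> nonneg_orthant"
  shows "Re (\<Sum>k\<in>UNIV. s $ k * of_real (x $ k)) \<le> 0"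
  using assms by (auto simp: nonneg_orthant_def intro!: sum_nonpos mult_nonpos_nonneg)

text \<open>The constant \<open>c\<close> covers the two integrals at hand: the Laplace transform of a finite measure
  (\<open>c = 0\<close>) and the integral part of the exponent of a subordinator (\<open>c = 1\<close>), where subtracting 1
  compensates for the infinite mass that a Levy measure may have near the origin.\<close>

lemma LINT_exp_separately_holomorphic:
  fixes N :: "(real ^ 'd) measure" and s :: "complex ^ 'd" and c :: complex and j :: 'd
  assumes N: "sets N = sets borel"
    and s: "\<And>k. Re (s $ k) \<le> 0"
    and dom: "\<And>b. \<exists>g. integrable N g \<and> (\<forall>s x. (\<forall>k. Re (s $ k) \<le> 0) \<longrightarrow> (\<Sum>k\<in>UNIV. norm (s $ k)) \<le> b
                \<longrightarrow> x \<in> nonneg_orthant \<longrightarrow> norm (exp (\<Sum>k\<in>UNIV. s $ k * of_real (x $ k)) - c) \<le> g x)"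
  defines "G \<equiv> \<lambda>z. LINT x:nonneg_orthant|N.
              (exp (\<Sum>k\<in>UNIV. replace_coord s j z $ k * of_real (x $ k)) - c)"
  shows "continuous_on {z. Re z \<le> 0} G" and "G holomorphic_on {z. Re z < 0}"
proof -
  define f where "f z x = indicat_real nonneg_orthant x *\<^sub>R
      (exp (\<Sum>k\<in>UNIV. replace_coord s j z $ k * of_real (x $ k)) - c)" for z and x :: "real ^ 'd"
  have G: "G = (\<lambda>z. LINT x|N. f z x)"
    unfolding G_def f_def set_lebesgue_integral_def ..
  have meas: "f z \<in> borel_measurable N" for z
    unfolding f_def measurable_cong_sets[OF N refl] by measurable
  have hol: "(\<lambda>z. f z x) holomorphic_on A" for x A
  proof -
    have "(\<lambda>z. \<Sum>k\<in>UNIV. replace_coord s j z $ k * of_real (x $ k)) holomorphic_on A"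
      by (intro holomorphic_intros)
    then show ?thesis
      unfolding f_def scaleR_conv_of_real by (intro holomorphic_intros)
  qed
  have bound: "\<exists>g r. r > 0 \<and> integrable N g \<and>
      (\<forall>w\<in>A \<inter> ball z r. \<forall>x\<in>space N. norm (f w x) \<le> g x)" if "A \<subseteq> {z. Re z \<le> 0}" for z A
  proof -
    define b where "b = norm z + 1 + (\<Sum>k\<in>UNIV. norm (s $ k))"
    obtain g where g: "integrable N g"
      and le_g: "\<And>s x. (\<And>k. Re (s $ k) \<le> 0) \<Longrightarrow> (\<Sum>k\<in>UNIV. norm (s $ k)) \<le> b \<Longrightarrow>
          x \<in> nonneg_orthant \<Longrightarrow> norm (exp (\<Sum>k\<in>UNIV. s $ k * of_real (x $ k)) - c) \<le> g x"
      using dom[of b] by metis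
    have "norm (f w x) \<le> \<bar>g x\<bar>" if w: "w \<in> A \<inter> ball z 1" for w x
    proof (cases "x \<in> nonneg_orthant")
      case True
      have "norm w \<le> norm z + 1"
        using w norm_triangle_ineq2[of w z] by (auto simp: dist_norm norm_minus_commute)
      moreover have "(\<Sum>k\<in>UNIV. norm (replace_coord s j w $ k))
          = norm w + (\<Sum>k\<in>UNIV - {j}. norm (s $ k))"
        by (subst sum.remove[of _ j]) (auto intro!: sum.cong)
      moreover have "(\<Sum>k\<in>UNIV - {j}. norm (s $ k)) \<le> (\<Sum>k\<in>UNIV. norm (s $ k))"
        by (intro sum_mono2) auto
      ultimately have "(\<Sum>k\<in>UNIV. norm (replace_coord s j w $ k)) \<le> b"
        by (simp add: b_def)
      moreover have "Re (replace_coord s j w $ k) \<le> 0" for k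
        using s w \<open>A \<subseteq> _\<close> by auto
      ultimately have "norm (exp (\<Sum>k\<in>UNIV. replace_coord s j w $ k * of_real (x $ k)) - c) \<le> g x"
        using True by (intro le_g) auto
      then show ?thesis using True by (simp add: f_def)
    qed (simp add: f_def)
    then show ?thesis
      using g by (intro exI[of _ "\<lambda>x. \<bar>g x\<bar>"] exI[of _ 1]) auto
  qed
  show "continuous_on {z. Re z \<le> 0} G"
    unfolding G
    by (rule continuous_on_LINT_dominated)
       (auto intro: meas holomorphic_on_imp_continuous_on hol bound)
  show "G holomorphic_on {z. Re z < 0}"
    unfolding G
  proof (rule holomorphic_on_LINT)
    show "open {z. Re z < 0}" by (intro open_Collect_less continuous_intros)
    show "\<exists>g r. r > 0 \<and> integrable N g \<and>
      (\<forall>w\<in>{z. Re z < 0} \<inter> ball z r. \<forall>x\<in>space N. norm (f w x) \<le> g x)" for z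
      by (rule bound) auto
  qed (auto intro: meas hol)
qed

text \<open>The two sides agree on the imaginary points by assumption. The induction is on the set of
  coordinates that are allowed to leave the imaginary axis: for a new coordinate the induction
  hypothesis supplies agreement on the boundary of the half plane.\<close>

lemma laplace_transform_of_characteristic_function:
  fixes P F :: "(real ^ 'd) measure" and b :: "real ^ 'd" and s :: "complex ^ 'd"
  assumes P: "sets P = sets borel" "finite_measure P"
    and F: "sets F = sets borel" "set_integrable F nonneg_orthant (\<lambda>x. min 1 (norm x))"
  defines "psi \<equiv> \<lambda>s. (\<Sum>j\<in>UNIV. of_real (b $ j) * s $ j) +
      (LINT x:nonneg_orthant|F. (exp (\<Sum>j\<in>UNIV. s $ j * of_real (x $ j)) - 1))"
  assumes fourier: "\<And>u :: real ^ 'd. (LINT x:nonneg_orthant|P. iexp (inner x u)) =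
      exp (of_real t * psi (\<chi> j. \<i> * of_real (u $ j)))"
    and s: "\<And>j. Re (s $ j) \<le> 0"
  shows "(LINT x:nonneg_orthant|P. exp (\<Sum>j\<in>UNIV. s $ j * of_real (x $ j))) = exp (of_real t * psi s)"
proof -
  interpret P: finite_measure P by fact
  define G where "G s = (LINT x:nonneg_orthant|P. (exp (\<Sum>j\<in>UNIV. s $ j * of_real (x $ j)) - 0))"
    for s :: "complex ^ 'd"
  define h where "h s = G s - exp (of_real t * psi s)" for s :: "complex ^ 'd"
  have domP: "\<exists>g. integrable P g \<and> (\<forall>s x. (\<forall>k. Re (s $ k) \<le> 0) \<longrightarrow> (\<Sum>k\<in>UNIV. norm (s $ k)) \<le> r
      \<longrightarrow> x \<in> nonneg_orthant \<longrightarrow> norm (exp (\<Sum>k\<in>UNIV. s $ k * of_real (x $ k)) - 0) \<le> g x)" for r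
  proof (intro exI[of _ "\<lambda>_. 1"] conjI allI impI)
    fix s :: "complex ^ 'd" and x :: "real ^ 'd"
    assume "\<forall>k. Re (s $ k) \<le> 0" "x \<in> nonneg_orthant"
    then show "norm (exp (\<Sum>k\<in>UNIV. s $ k * of_real (x $ k)) - 0) \<le> 1"
      using Re_linear_nonpos[of s x] by simp
  qed simp
  \<comment> \<open>On the left half plane \<open>exp w - 1\<close> is bounded by 2 and by \<open>norm w\<close>: the first bound handles
    large \<open>x\<close>, the second one small \<open>x\<close>.\<close>
  have domF: "\<exists>g. integrable F g \<and> (\<forall>s x. (\<forall>k. Re (s $ k) \<le> 0) \<longrightarrow> (\<Sum>k\<in>UNIV. norm (s $ k)) \<le> r
      \<longrightarrow> x \<in> nonneg_orthant \<longrightarrow> norm (exp (\<Sum>k\<in>UNIV. s $ k * of_real (x $ k)) - 1) \<le> g x)" for r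
  proof (intro exI[of _ "\<lambda>x. (2 + r) * (indicator nonneg_orthant x *\<^sub>R min 1 (norm x))"] conjI allI impI)
    show "integrable F (\<lambda>x. (2 + r) * (indicator nonneg_orthant x *\<^sub>R min 1 (norm x)))"
      using F(2) unfolding set_integrable_def by (rule integrable_mult_right)
    fix s :: "complex ^ 'd" and x :: "real ^ 'd"
    assume s: "\<forall>k. Re (s $ k) \<le> 0" "(\<Sum>k\<in>UNIV. norm (s $ k)) \<le> r" and x: "x \<in> nonneg_orthant"
    define w where "w = (\<Sum>k\<in>UNIV. s $ k * complex_of_real (x $ k))"
    have w: "Re w \<le> 0" unfolding w_def using Re_linear_nonpos s x by blast
    have "norm w \<le> (\<Sum>k\<in>UNIV. norm (s $ k) * norm x)"
      unfolding w_def
      by (intro order_trans[OF norm_sum] sum_mono)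
         (auto simp: norm_mult intro!: mult_left_mono component_le_norm_cart)
    also have "\<dots> \<le> r * norm x"
      using s(2) by (simp add: sum_distrib_right[symmetric] mult_right_mono)
    finally have "norm (exp w - 1) \<le> r * norm x"
      using norm_exp_minus_one_le[OF w] by linarith
    moreover have "norm (exp w - 1) \<le> 2"
    proof -
      have "norm (exp w - 1) \<le> exp (Re w) + 1"
        using norm_triangle_ineq4[of "exp w" 1] by simp
      moreover have "exp (Re w) \<le> 1" using w by simp
      ultimately show ?thesis by linarith
    qed
    moreover have "0 \<le> r"
      using s(2) by (meson norm_ge_zero order_trans sum_nonneg)
    moreover have "e \<le> (2 + r) * min 1 y" if "e \<le> r * y" "e \<le> 2" "0 \<le> r" "0 \<le> y" for e y :: real
      using that unfolding distrib_right by (cases "1 \<le> y") (simp_all add: min_def)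
    ultimately have "norm (exp w - 1) \<le> (2 + r) * min 1 (norm x)"
      by (simp only: norm_ge_zero)
    then show "norm (exp (\<Sum>k\<in>UNIV. s $ k * complex_of_real (x $ k)) - 1)
        \<le> (2 + r) * (indicator nonneg_orthant x *\<^sub>R min 1 (norm x))"
      using x by (simp add: w_def)
  qed
  have "h s = 0" if "finite J" "\<And>k. Re (s $ k) \<le> 0" "\<And>k. k \<notin> J \<Longrightarrow> Re (s $ k) = 0" for J s
    using that
  proof (induction J arbitrary: s rule: finite_induct)
    case empty
    define u :: "real ^ 'd" where "u = (\<chi> j. Im (s $ j))"
    have s: "s = (\<chi> j. \<i> * of_real (u $ j))"
      using empty by (simp add: vec_eq_iff complex_eq_iff u_def)
    have "iexp (inner x u) = exp (\<Sum>j\<in>UNIV. s $ j * of_real (x $ j))" for x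
      by (simp add: s inner_vec_def sum_distrib_left mult_ac)
    then show ?case
      using fourier[of u] unfolding h_def G_def s[symmetric] by simp
  next
    case (insert j J)
    have "h (replace_coord s j z) = 0" if z: "Re z \<le> 0" for z
    proof (rule zero_on_left_half_plane[OF _ _ _ z])
      note hP = LINT_exp_separately_holomorphic[OF P(1) insert.prems(1) domP, of j]
      note hF = LINT_exp_separately_holomorphic[OF F(1) insert.prems(1) domF, of j]
      have lin: "(\<lambda>z. \<Sum>k\<in>UNIV. of_real (b $ k) * replace_coord s j z $ k) holomorphic_on A" for A
        by (intro holomorphic_intros)
      show "continuous_on {z. Re z \<le> 0} (\<lambda>z. h (replace_coord s j z))"
        unfolding h_def G_def psi_def
        by (intro continuous_intros hP hF holomorphic_on_imp_continuous_on[OF lin])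
      show "(\<lambda>z. h (replace_coord s j z)) holomorphic_on {z. Re z < 0}"
        unfolding h_def G_def psi_def by (intro holomorphic_intros hP hF lin)
      show "h (replace_coord s j z) = 0" if "Re z = 0" for z
        using that insert.prems by (intro insert.IH) auto
    qed
    moreover have "replace_coord s j (s $ j) = s"
      by (simp add: vec_eq_iff)
    ultimately show ?case
      using insert.prems(1) by metis
  qed
  from this[of UNIV s] s show ?thesis
    by (simp add: h_def G_def)
qed

section \<open>The exponent of a subordinator in terms of its triplet\<close>

text \<open>Near the origin integrability comes from the truncation function, and away from it from the
  finiteness of a Levy measure outside a neighbourhood of 0.\<close>

lemma levy_measure_integrable_min_norm:
  assumes F: "levy_measure F" and trunc: "set_integrable F nonneg_orthant trunc"
  shows "set_integrable F nonneg_orthant (\<lambda>x :: real ^ 'd. min 1 (norm x))"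
  unfolding set_integrable_def
proof (rule Bochner_Integration.integrable_bound)
  have sets: "sets F = sets borel" using F by (simp add: levy_measure_def)
  have "integrable F (\<lambda>x. min 1 ((norm x)\<^sup>2))"
    unfolding integrable_iff_bounded measurable_cong_sets[OF sets refl]
    using F by (simp add: levy_measure_def)
  then show "integrable F (\<lambda>x. norm (indicat_real nonneg_orthant x *\<^sub>R trunc x) + min 1 ((norm x)\<^sup>2))"
    using trunc unfolding set_integrable_def by (intro Bochner_Integration.integrable_add integrable_norm)
  show "(\<lambda>x. indicat_real nonneg_orthant x *\<^sub>R min 1 (norm x)) \<in> borel_measurable F"
    unfolding measurable_cong_sets[OF sets refl] by measurable
  have "1 \<le> y * y" if "1 \<le> y" for y :: real
    using mult_mono[of 1 y 1 y] that by simp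
  then show "AE x in F. norm (indicat_real nonneg_orthant x *\<^sub>R min 1 (norm x))
      \<le> norm (norm (indicat_real nonneg_orthant x *\<^sub>R trunc x) + min 1 ((norm x)\<^sup>2))"
    by (intro AE_I2) (auto simp: indicator_def trunc_def min_def power2_eq_square)
qed

text \<open>Since the truncation function is integrable, the compensating term can be split off from the
  integral and merged with \<open>a\<close> into the drift.\<close>

lemma levy_khintchine_exponent_eq:
  fixes F :: "(real ^ 'd) measure"
  assumes F: "levy_measure F" and conc: "AE x in F. x \<in> nonneg_orthant"
    and trunc: "set_integrable F nonneg_orthant trunc"
  shows "\<i> * of_real (inner a u) - of_real (inner u ((0 :: real ^ 'd ^ 'd) *v u)) / 2
      + (LINT x|F. (iexp (inner x u) - 1 - \<i> * of_real (inner (trunc x) u)))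
    = subordinator_exponent a F (\<chi> j. \<i> * of_real (u $ j))"
proof -
  have sets: "sets F = sets borel" using F by (simp add: levy_measure_def)
  let ?e = "\<lambda>x. indicat_real nonneg_orthant x *\<^sub>R (iexp (inner x u) - 1)"
  let ?t = "\<lambda>x. indicat_real nonneg_orthant x *\<^sub>R trunc x"
  have e: "integrable F ?e"
  proof (rule Bochner_Integration.integrable_bound)
    show "integrable F (\<lambda>x. (2 + norm u) * (indicat_real nonneg_orthant x *\<^sub>R min 1 (norm x)))"
      using levy_measure_integrable_min_norm[OF F trunc] unfolding set_integrable_def
      by (rule integrable_mult_right)
    show "?e \<in> borel_measurable F"
      unfolding measurable_cong_sets[OF sets refl] by measurable
    have "norm (iexp (inner x u) - 1) \<le> (2 + norm u) * min 1 (norm x)" for x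
    proof -
      have "norm (iexp (inner x u) - 1) \<le> 2"
        using norm_triangle_ineq4[of "iexp (inner x u)" 1] by simp
      moreover have "norm (iexp (inner x u) - 1) \<le> \<bar>inner x u\<bar>"
        using norm_exp_minus_one_le[of "\<i> * of_real (inner x u)"] by (simp add: norm_mult)
      moreover have "\<bar>inner x u\<bar> \<le> norm u * norm x"
        using Cauchy_Schwarz_ineq2[of x u] by (simp add: mult.commute)
      moreover have "e \<le> (2 + c) * min 1 y" if "e \<le> 2" "e \<le> d" "d \<le> c * y" "0 \<le> c" "0 \<le> y"
        for e c d y :: real
        using that unfolding distrib_right by (cases "1 \<le> y") (simp_all add: min_def)
      ultimately show ?thesis by (meson norm_ge_zero)
    qed
    then show "AE x in F. norm (?e x) \<le> norm ((2 + norm u) * (indicat_real nonneg_orthant x *\<^sub>R min 1 (norm x)))"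
      by (intro AE_I2) (auto simp: indicator_def abs_mult)
  qed
  have t: "integrable F ?t" using trunc by (simp add: set_integrable_def)
  have t': "integrable F (\<lambda>x. \<i> * complex_of_real (inner (?t x) u))"
    using t by (intro integrable_mult_right integrable_of_real integrable_inner_left) auto
  have "(LINT x|F. (iexp (inner x u) - 1 - \<i> * of_real (inner (trunc x) u)))
      = (LINT x|F. ?e x - \<i> * of_real (inner (?t x) u))"
  proof (rule integral_cong_AE)
    show "(\<lambda>x. iexp (inner x u) - 1 - \<i> * of_real (inner (trunc x) u)) \<in> borel_measurable F"
      unfolding measurable_cong_sets[OF sets refl] trunc_def[abs_def] by measurable
    show "AE x in F. iexp (inner x u) - 1 - \<i> * of_real (inner (trunc x) u) = ?e x - \<i> * of_real (inner (?t x) u)"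
      using conc by eventually_elim simp
  qed (use e t' in auto)
  also have "\<dots> = (LINT x|F. ?e x) - (LINT x|F. \<i> * of_real (inner (?t x) u))"
    by (rule Bochner_Integration.integral_diff[OF e t'])
  also have "(LINT x|F. \<i> * complex_of_real (inner (?t x) u)) = \<i> * of_real (inner (LINT x|F. ?t x) u)"
  proof -
    have inner: "(LINT x|F. inner (?t x) u) = inner (LINT x|F. ?t x) u"
      using t by (intro integral_inner_left)
    show ?thesis
      unfolding inner[symmetric] integral_complex_of_real[symmetric] by (rule integral_mult_right_zero)
  qed
  finally have "\<i> * of_real (inner a u) + (LINT x|F. (iexp (inner x u) - 1 - \<i> * of_real (inner (trunc x) u)))
      = \<i> * of_real (inner (drift0 a F) u) + (LINT x|F. ?e x)"
    by (simp add: drift0_def set_lebesgue_integral_def inner_diff_left algebra_simps)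
  moreover have "\<i> * complex_of_real (inner (drift0 a F) u)
      = (\<Sum>j\<in>UNIV. of_real (drift0 a F $ j) * (\<i> * of_real (u $ j)))"
    by (simp add: inner_vec_def sum_distrib_left mult_ac)
  moreover have "iexp (inner x u) = exp (\<Sum>j\<in>UNIV. \<i> * of_real (u $ j) * of_real (x $ j))" for x
    by (simp add: inner_vec_def sum_distrib_left mult_ac)
  ultimately show ?thesis
    by (simp add: subordinator_exponent_def set_lebesgue_integral_def)
qed

section \<open>Measurability and regularity of a process at a random time\<close>

text \<open>A vector is the sum of its coordinates placed on the axes, so measurability reduces to that of
  sums and of the continuous axis embeddings.\<close>

lemma borel_measurable_vec_lambda:
  fixes f :: "'d::finite \<Rightarrow> 'x \<Rightarrow> 'h::{real_inner,polish_space}"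
  assumes "\<And>j. f j \<in> borel_measurable N"
  shows "(\<lambda>x. \<chi> j. f j x) \<in> borel_measurable N"
proof -
  have *: "continuous_on UNIV (axis j :: 'h \<Rightarrow> 'h ^ 'd)" for j
    unfolding axis_def
  proof (intro continuous_on_vec_lambda)
    show "continuous_on UNIV (\<lambda>x::'h. if i = j then x else 0)" for i
      by (cases "i = j") auto
  qed
  have "(\<chi> j. f j x) = (\<Sum>j\<in>UNIV. axis j (f j x))" for x
    by (simp add: vec_eq_iff axis_def)
  moreover have "(\<lambda>x. \<Sum>j\<in>UNIV. axis j (f j x)) \<in> borel_measurable N"
    using assms
    by (intro borel_measurable_sum measurable_compose[OF _ borel_measurable_continuous_onI[OF *]]) auto
  ultimately show ?thesis by simp
qed

lemma borel_measurable_vec_component: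
  fixes f :: "'x \<Rightarrow> 'h::{real_inner,polish_space} ^ 'd::finite"
  assumes "f \<in> borel_measurable N"
  shows "(\<lambda>x. f x $ j) \<in> borel_measurable N"
  by (rule measurable_compose[OF assms borel_measurable_continuous_onI]) (intro continuous_intros)

lemma space_process_algebra [simp]: "space (process_algebra M X) = space M"
  by (simp add: process_algebra_def)

lemma measurable_process_algebra:
  assumes "0 \<le> t"
  shows "X t \<in> borel_measurable (process_algebra M X)"
proof -
  have "trajectory X \<in> measurable (process_algebra M X) trajectory_space"
    unfolding process_algebra_def
    by (rule measurable_vimage_algebra1) (auto simp: trajectory_def space_PiM)
  then have "(\<lambda>\<omega>. trajectory X \<omega> t) \<in> borel_measurable (process_algebra M X)"
    by (rule measurable_compose) (use assms in \<open>auto intro: measurable_component_singleton\<close>)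
  then show ?thesis
    using assms by (simp add: trajectory_def)
qed

text \<open>Evaluation at a time with countably many values is measurable, and right continuity lets an
  arbitrary random time be approximated strictly from the right by such times. The random time \<open>g x\<close>
  and the path \<open>f x\<close> are independent parameters, which covers evaluation on a product space. The
  maximum with 0 keeps the times in the index set of the process.\<close>

lemma right_continuous_process_at_random_time:
  fixes Y :: "real \<Rightarrow> 'w \<Rightarrow> 'a::metric_space"
  assumes meas: "\<And>t. 0 \<le> t \<Longrightarrow> Y t \<in> borel_measurable N"
    and right_cont: "\<And>\<omega> t. \<omega> \<in> space N \<Longrightarrow> 0 \<le> t \<Longrightarrow> ((\<lambda>s. Y s \<omega>) \<longlongrightarrow> Y t \<omega>) (at_right t)"
    and f [measurable]: "f \<in> measurable Q N" and g [measurable]: "g \<in> borel_measurable Q"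
  shows "(\<lambda>x. Y (max 0 (g x)) (f x)) \<in> borel_measurable Q"
proof (rule borel_measurable_LIMSEQ_metric)
  \<comment> \<open>The smallest multiple of \<open>1 / (n + 1)\<close> that is strictly greater than the time.\<close>
  define a :: "nat \<Rightarrow> int \<Rightarrow> real" where "a n k = max 0 ((of_int k + 1) / real (Suc n))" for n k
  define m where "m n x = \<lfloor>real (Suc n) * max 0 (g x)\<rfloor>" for n x
  show "(\<lambda>x. Y (a n (m n x)) (f x)) \<in> borel_measurable Q" for n
  proof (rule measurable_compose_countable)
    show "(\<lambda>x. Y (a n k) (f x)) \<in> borel_measurable Q" for k
      by (rule measurable_compose[OF f meas]) (simp add: a_def)
    show "m n \<in> measurable Q (count_space UNIV)"
      unfolding m_def by measurable
  qed
  fix x assume x: "x \<in> space Q"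
  define r where "r = max 0 (g x)"
  have r: "0 \<le> r" by (simp add: r_def)
  have upper: "a n (m n x) \<le> r + inverse (real (Suc n))"
    and lower: "r < a n (m n x)" for n
  proof -
    have "of_int (m n x) \<le> real (Suc n) * r" "real (Suc n) * r < of_int (m n x) + 1"
      unfolding m_def r_def by linarith+
    moreover have "a n (m n x) = (of_int (m n x) + 1) / real (Suc n)"
      using r unfolding a_def m_def r_def by (intro max_absorb2 divide_nonneg_nonneg) auto
    moreover have "(k + 1) / q \<le> r + inverse q" "r < (k + 1) / q"
      if "0 < q" "k \<le> q * r" "q * r < k + 1" for k q :: real
      using that by (simp_all add: field_simps)
    ultimately show "a n (m n x) \<le> r + inverse (real (Suc n))" "r < a n (m n x)"
      by (simp_all only: of_nat_0_less_iff zero_less_Suc)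
  qed
  have "(\<lambda>n. a n (m n x)) \<longlonglongrightarrow> r"
  proof (rule tendsto_sandwich[of "\<lambda>_. r"])
    show "(\<lambda>n. r + inverse (real (Suc n))) \<longlonglongrightarrow> r"
      using tendsto_add[OF tendsto_const LIMSEQ_inverse_real_of_nat] by simp
  qed (use upper lower in \<open>auto intro!: always_eventually less_imp_le\<close>)
  then have "filterlim (\<lambda>n. a n (m n x)) (at_right r) sequentially"
    using lower by (auto simp: filterlim_at intro!: always_eventually)
  moreover have "((\<lambda>s. Y s (f x)) \<longlongrightarrow> Y r (f x)) (at_right r)"
    using measurable_space[OF f x] r by (rule right_cont)
  ultimately show "(\<lambda>n. Y (a n (m n x)) (f x)) \<longlonglongrightarrow> Y (max 0 (g x)) (f x)"
    unfolding r_def[symmetric] by (rule filterlim_compose[rotated])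
qed

text \<open>Times with negative components are projected to the orthant, so that functions of the time vector
  can be total and measurable on the whole space.\<close>

definition nonneg_part :: "real ^ 'd \<Rightarrow> real ^ 'd"
  where "nonneg_part \<theta> = (\<chi> j. max 0 (\<theta> $ j))"

lemma nonneg_part_eq: "\<theta> \<in> nonneg_orthant \<Longrightarrow> nonneg_part \<theta> = \<theta>"
  by (simp add: nonneg_part_def nonneg_orthant_def vec_eq_iff)

text \<open>From the right, \<open>\<theta> s\<close> approaches \<open>\<theta> t\<close> from the right or coincides with it. From the left, \<open>\<theta>\<close>
  increases to a limit \<open>c\<close>: if it reaches \<open>c\<close> before \<open>t\<close>, the composition is eventually constant, and
  otherwise it approaches \<open>c\<close> strictly from below, where \<open>y\<close> has a left limit.\<close>

lemma cadlag_compose_nondecreasing: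
  fixes y :: "real \<Rightarrow> 'a::topological_space" and \<theta> :: "real \<Rightarrow> real"
  assumes y_right: "\<And>t. 0 \<le> t \<Longrightarrow> (y \<longlongrightarrow> y t) (at_right t)"
    and y_left: "\<And>t. 0 < t \<Longrightarrow> \<exists>l. (y \<longlongrightarrow> l) (at_left t)"
    and nonneg: "\<And>t. 0 \<le> t \<Longrightarrow> 0 \<le> \<theta> t"
    and mono: "\<And>s t. 0 \<le> s \<Longrightarrow> s \<le> t \<Longrightarrow> \<theta> s \<le> \<theta> t"
    and \<theta>_right: "\<And>t. 0 \<le> t \<Longrightarrow> (\<theta> \<longlongrightarrow> \<theta> t) (at_right t)"
    and \<theta>_left: "\<And>t. 0 < t \<Longrightarrow> \<exists>l. (\<theta> \<longlongrightarrow> l) (at_left t)"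
  shows "0 \<le> t \<Longrightarrow> ((\<lambda>s. y (\<theta> s)) \<longlongrightarrow> y (\<theta> t)) (at_right t)"
    and "0 < t \<Longrightarrow> \<exists>l. ((\<lambda>s. y (\<theta> s)) \<longlongrightarrow> l) (at_left t)"
proof -
  assume t: "0 \<le> t"
  show "((\<lambda>s. y (\<theta> s)) \<longlongrightarrow> y (\<theta> t)) (at_right t)"
  proof -
    have "(y \<longlongrightarrow> y (\<theta> t)) (at (\<theta> t) within {\<theta> t..})"
      using y_right[OF nonneg[OF t]] by (simp add: at_within_Ici_at_right)
    then have cont: "continuous (at (\<theta> t) within {\<theta> t..}) y"
      by (simp add: continuous_within)
    show ?thesis
    proof (rule continuous_within_tendsto_compose[OF cont])
      show "eventually (\<lambda>s. \<theta> s \<in> {\<theta> t..}) (at_right t)"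
        using mono t by (auto simp: eventually_at_filter intro!: always_eventually)
    qed (rule \<theta>_right[OF t])
  qed
next
  assume t: "0 < t"
  obtain c where c: "(\<theta> \<longlongrightarrow> c) (at_left t)"
    using \<theta>_left[OF t] by blast
  have ev: "eventually (\<lambda>s. s' < s \<and> s < t) (at_left t)" if "s' < t" for s'
    using that eventually_at_left by blast
  have le_c: "\<theta> s \<le> c" if s: "0 \<le> s" "s < t" for s
  proof (rule tendsto_lowerbound[OF c])
    show "eventually (\<lambda>r. \<theta> s \<le> \<theta> r) (at_left t)"
      using ev[OF s(2)] by eventually_elim (use s mono in auto)
  qed simp
  show "\<exists>l. ((\<lambda>s. y (\<theta> s)) \<longlongrightarrow> l) (at_left t)"
  proof (cases "\<exists>s. 0 \<le> s \<and> s < t \<and> \<theta> s = c")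
    case True
    then obtain s where s: "0 \<le> s" "s < t" "\<theta> s = c" by blast
    have "eventually (\<lambda>r. y (\<theta> r) = y c) (at_left t)"
      using ev[OF s(2)]
    proof eventually_elim
      case (elim r)
      then have "\<theta> r = c"
        using mono[of s r] le_c[of r] s by auto
      then show ?case by simp
    qed
    then have "((\<lambda>r. y (\<theta> r)) \<longlongrightarrow> y c) (at_left t)"
      by (rule tendsto_eventually)
    then show ?thesis by blast
  next
    case False
    then have less_c: "\<theta> s < c" if "0 \<le> s" "s < t" for s
      using le_c[OF that] that by force
    have "0 < c"
      using less_c[of 0] t nonneg[of 0] by simp
    then obtain l where l: "(y \<longlongrightarrow> l) (at_left c)"
      using y_left by blast
    have "filterlim \<theta> (at_left c) (at_left t)"
      unfolding filterlim_at
    proof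
      show "eventually (\<lambda>s. \<theta> s \<in> {..<c} \<and> \<theta> s \<noteq> c) (at_left t)"
        using ev[OF t]
      proof eventually_elim
        case (elim s)
        then have "\<theta> s < c" by (intro less_c) auto
        then show ?case by simp
      qed
    qed (rule c)
    from filterlim_compose[OF l this] show ?thesis by blast
  qed
qed

section \<open>Independence\<close>

context prob_space
begin

text \<open>The identity map, read once as a random variable with values in \<open>A\<close> and once in \<open>B\<close>, turns
  independence of the two sigma-algebras into the statement that \<open>\<omega> \<mapsto> (\<omega>, \<omega>)\<close> has a product law.
  Then the formula is Fubini's theorem: the second argument is frozen while the first is averaged.\<close>

lemma freezing:
  fixes f :: "'a \<times> 'a \<Rightarrow> 'b::{banach,second_countable_topology}"
  assumes indep: "indep_set (sets A) (sets B)" and space: "space A = space M" "space B = space M"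
    and f [measurable]: "f \<in> borel_measurable (A \<Otimes>\<^sub>M B)"
    and bound: "\<And>x. norm (f x) \<le> c"
  shows "(LINT \<omega>|M. f (\<omega>, \<omega>)) = (LINT \<omega>'|M. LINT \<omega>|M. f (\<omega>, \<omega>'))"
proof -
  have sub: "sets A \<subseteq> events" "sets B \<subseteq> events"
    using indep unfolding indep_sets2_eq by auto
  have [measurable]: "(\<lambda>\<omega>. \<omega>) \<in> measurable M A" "(\<lambda>\<omega>. \<omega>) \<in> measurable M B"
    using sub space sets.sets_into_space by (auto simp: measurable_def Int_absorb2)
  have "sigma_sets (space M) {(\<lambda>\<omega>. \<omega>) -` S \<inter> space M |S. S \<in> sets C} = sets C"
    if "space C = space M" for C
  proof -
    have "{(\<lambda>\<omega>. \<omega>) -` S \<inter> space M |S. S \<in> sets C} = sets C"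
      using that sets.sets_into_space[of _ C] by (auto simp: Int_absorb2)
    then show ?thesis
      using sets.sigma_sets_eq[of C] that by simp
  qed
  then have "indep_var A (\<lambda>\<omega>. \<omega>) B (\<lambda>\<omega>. \<omega>)"
    unfolding indep_var_eq using indep space by simp
  then have joint: "distr M A (\<lambda>\<omega>. \<omega>) \<Otimes>\<^sub>M distr M B (\<lambda>\<omega>. \<omega>) = distr M (A \<Otimes>\<^sub>M B) (\<lambda>\<omega>. (\<omega>, \<omega>))"
    unfolding indep_var_distribution_eq by blast
  interpret PA: prob_space "distr M A (\<lambda>\<omega>. \<omega>)" by (rule prob_space_distr) measurable
  interpret PB: prob_space "distr M B (\<lambda>\<omega>. \<omega>)" by (rule prob_space_distr) measurable
  interpret P: pair_prob_space "distr M A (\<lambda>\<omega>. \<omega>)" "distr M B (\<lambda>\<omega>. \<omega>)" ..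
  have int: "integrable (distr M A (\<lambda>\<omega>. \<omega>) \<Otimes>\<^sub>M distr M B (\<lambda>\<omega>. \<omega>)) f"
    by (rule P.integrable_const_bound[where B = c]) (use bound in auto)
  have "(LINT \<omega>|M. f (\<omega>, \<omega>)) = (LINT x|distr M (A \<Otimes>\<^sub>M B) (\<lambda>\<omega>. (\<omega>, \<omega>)). f x)"
    by (rule integral_distr[symmetric]) measurable
  also have "\<dots> = (LINT y|distr M B (\<lambda>\<omega>. \<omega>). LINT x|distr M A (\<lambda>\<omega>. \<omega>). f (x, y))"
    using P.integral_snd[of "\<lambda>x y. f (x, y)"] int by (simp add: joint)
  also have "\<dots> = (LINT y|M. LINT x|distr M A (\<lambda>\<omega>. \<omega>). f (x, y))"
    by (rule integral_distr) measurable
  also have "\<dots> = (LINT y|M. LINT x|M. f (x, y))"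
  proof (rule Bochner_Integration.integral_cong[OF refl])
    fix y assume "y \<in> space M"
    then have "y \<in> space B" by (simp add: space)
    then show "(LINT x|distr M A (\<lambda>\<omega>. \<omega>). f (x, y)) = (LINT x|M. f (x, y))"
      by (intro integral_distr) measurable
  qed
  finally show ?thesis .
qed

text \<open>Independent columns, each of which consists of independent entries, form an independent grid: a
  product event of the grid is an intersection of one event per column, and both factorizations
  apply one after the other.\<close>

lemma indep_vars_grid:
  assumes I: "finite I" "I \<noteq> {}" and J: "finite J" "J \<noteq> {}"
    and columns: "indep_vars N T J"
    and g: "\<And>i j. i \<in> I \<Longrightarrow> j \<in> J \<Longrightarrow> g i j \<in> measurable (N j) K"
    and within: "\<And>j. j \<in> J \<Longrightarrow> indep_vars (\<lambda>_. K) (\<lambda>i \<omega>. g i j (T j \<omega>)) I"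
  shows "indep_vars (\<lambda>_. K) (\<lambda>(i, j) \<omega>. g i j (T j \<omega>)) (I \<times> J)"
proof -
  have T: "T j \<in> measurable M (N j)" if "j \<in> J" for j
    using columns that by (auto simp: indep_vars_def)
  have gT: "(\<lambda>\<omega>. g i j (T j \<omega>)) \<in> measurable M K" if "i \<in> I" "j \<in> J" for i j
    by (rule measurable_compose[OF T g]) (use that in auto)
  show ?thesis
  proof (subst indep_vars_finite[where E = "\<lambda>_. sets K"])
    show "\<forall>A\<in>I \<times> J \<rightarrow> sets K. prob (\<Inter>p\<in>I \<times> J. (case p of (i, j) \<Rightarrow> \<lambda>\<omega>. g i j (T j \<omega>)) -` A p \<inter> space M)
        = (\<Prod>p\<in>I \<times> J. prob ((case p of (i, j) \<Rightarrow> \<lambda>\<omega>. g i j (T j \<omega>)) -` A p \<inter> space M))"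
    proof
      fix A assume A: "A \<in> I \<times> J \<rightarrow> sets K"
      define C where "C j = (\<Inter>i\<in>I. g i j -` A (i, j) \<inter> space (N j))" for j
      have C: "C j \<in> sets (N j)" if "j \<in> J" for j
        unfolding C_def using A that g I by (intro sets.finite_INT) (auto intro!: measurable_sets[of _ _ K])
      have C_vimage: "T j -` C j \<inter> space M = (\<Inter>i\<in>I. (\<lambda>\<omega>. g i j (T j \<omega>)) -` A (i, j) \<inter> space M)"
        if "j \<in> J" for j
        using measurable_space[OF T[OF that]] I by (auto simp: C_def)
      have "(\<Inter>p\<in>I \<times> J. (case p of (i, j) \<Rightarrow> \<lambda>\<omega>. g i j (T j \<omega>)) -` A p \<inter> space M)
          = (\<Inter>j\<in>J. T j -` C j \<inter> space M)"
        using I J by (auto simp: C_vimage)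
      also have "prob \<dots> = (\<Prod>j\<in>J. prob (T j -` C j \<inter> space M))"
        by (rule indep_varsD_finite[OF columns J(2,1) C])
      also have "\<dots> = (\<Prod>j\<in>J. \<Prod>i\<in>I. prob ((\<lambda>\<omega>. g i j (T j \<omega>)) -` A (i, j) \<inter> space M))"
      proof (rule prod.cong[OF refl])
        fix j assume j: "j \<in> J"
        show "prob (T j -` C j \<inter> space M) = (\<Prod>i\<in>I. prob ((\<lambda>\<omega>. g i j (T j \<omega>)) -` A (i, j) \<inter> space M))"
          unfolding C_vimage[OF j]
          by (rule indep_varsD_finite[OF within[OF j] I(2,1)]) (use A j in auto)
      qed
      also have "\<dots> = (\<Prod>p\<in>I \<times> J. prob ((case p of (i, j) \<Rightarrow> \<lambda>\<omega>. g i j (T j \<omega>)) -` A p \<inter> space M))"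
        by (subst prod.swap) (simp add: prod.cartesian_product case_prod_beta)
      finally show "prob (\<Inter>p\<in>I \<times> J. (case p of (i, j) \<Rightarrow> \<lambda>\<omega>. g i j (T j \<omega>)) -` A p \<inter> space M) = \<dots>" .
    qed
  qed (use I J gT in \<open>auto intro: sets.Int_stable simp: sets.sigma_sets_eq dest: sets.sets_into_space\<close>)
qed

lemma indep_vars_vec_of_grid:
  fixes V :: "'i \<times> 'd::finite \<Rightarrow> 'a \<Rightarrow> 'h::{real_inner,polish_space}"
  assumes "indep_vars (\<lambda>_. borel) V (I \<times> UNIV)"
  shows "indep_vars (\<lambda>_. borel) (\<lambda>i \<omega>. \<chi> j. V (i, j) \<omega>) I"
proof -
  have "indep_vars (\<lambda>i. PiM ({i} \<times> UNIV) (\<lambda>_. borel))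
      (\<lambda>i \<omega>. restrict (\<lambda>p. V p \<omega>) ({i} \<times> UNIV)) I"
    by (rule indep_vars_restrict[OF assms]) (auto simp: disjoint_family_on_def)
  then have "indep_vars (\<lambda>_. borel)
      (\<lambda>i \<omega>. (\<lambda>f. \<chi> j. f (i, j)) (restrict (\<lambda>p. V p \<omega>) ({i} \<times> (UNIV :: 'd set)))) I"
    by (rule indep_vars_compose2) (intro borel_measurable_vec_lambda measurable_component_singleton, auto)
  then show ?thesis by simp
qed

text \<open>The law of a vector with independent components is the image of the product of the marginals.\<close>

lemma distr_vec_cong:
  fixes V V' :: "'d::finite \<Rightarrow> 'a \<Rightarrow> 'h::{real_inner,polish_space}"
  assumes V: "indep_vars (\<lambda>_. borel) V UNIV" and V': "indep_vars (\<lambda>_. borel) V' UNIV"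
    and eq: "\<And>j. distr M borel (V j) = distr M borel (V' j)"
  shows "distr M borel (\<lambda>\<omega>. \<chi> j. V j \<omega>) = distr M borel (\<lambda>\<omega>. \<chi> j. V' j \<omega>)"
proof -
  have law: "distr M borel (\<lambda>\<omega>. \<chi> j. W j \<omega>)
      = distr (PiM UNIV (\<lambda>j. distr M borel (W j))) borel (\<lambda>f. \<chi> j. f j)"
    if W: "indep_vars (\<lambda>_. borel) W UNIV" for W :: "'d \<Rightarrow> 'a \<Rightarrow> 'h"
  proof -
    have rv: "W j \<in> borel_measurable M" for j
      using W by (auto simp: indep_vars_def)
    have "distr M borel (\<lambda>\<omega>. \<chi> j. W j \<omega>)
        = distr (distr M (PiM UNIV (\<lambda>_. borel)) (\<lambda>\<omega>. \<lambda>j\<in>UNIV. W j \<omega>)) borel (\<lambda>f. \<chi> j. f j)"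
    proof (subst distr_distr)
      show "(\<lambda>\<omega>. \<lambda>j\<in>UNIV. W j \<omega>) \<in> measurable M (PiM UNIV (\<lambda>_. borel))"
        by (intro measurable_restrict rv)
      show "(\<lambda>f. \<chi> j. f j) \<in> borel_measurable (PiM UNIV (\<lambda>_::'d. borel :: 'h measure))"
        by (intro borel_measurable_vec_lambda measurable_component_singleton) simp
    qed (simp add: comp_def restrict_UNIV)
    with indep_vars_iff_distr_eq_PiM[of UNIV W "\<lambda>_. borel"] rv W show ?thesis by simp
  qed
  show ?thesis
    unfolding law[OF V] law[OF V'] eq ..
qed

text \<open>Factorization over the full index set covers all its subsets, since any of the sets \<open>A i\<close> can be
  the whole space. Stating it through expectations fits a setting in which conditioning produces
  expectations of products rather than probabilities of intersections.\<close>

lemma indep_varsI_expectation: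
  assumes fin: "finite I" and rv: "\<And>i. i \<in> I \<Longrightarrow> X i \<in> measurable M (N i)"
    and prod: "\<And>A. (\<And>i. i \<in> I \<Longrightarrow> A i \<in> sets (N i)) \<Longrightarrow>
      expectation (\<lambda>\<omega>. \<Prod>i\<in>I. indicator (A i) (X i \<omega>))
      = (\<Prod>i\<in>I. expectation (\<lambda>\<omega>. indicat_real (A i) (X i \<omega>)))"
  shows "indep_vars N X I"
proof (cases "I = {}")
  case True
  then show ?thesis by (simp add: indep_vars_def indep_sets_def)
next
  case False
  show ?thesis
  proof (subst indep_vars_finite[where E = "\<lambda>i. sets (N i)"])
    show "\<forall>A\<in>(\<Pi> i\<in>I. sets (N i)). prob (\<Inter>i\<in>I. X i -` A i \<inter> space M)
        = (\<Prod>i\<in>I. prob (X i -` A i \<inter> space M))"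
    proof
      fix A assume A: "A \<in> (\<Pi> i\<in>I. sets (N i))"
      have single: "prob (X i -` A i \<inter> space M) = expectation (\<lambda>\<omega>. indicat_real (A i) (X i \<omega>))"
        if "i \<in> I" for i
      proof -
        have "expectation (\<lambda>\<omega>. indicat_real (A i) (X i \<omega>))
            = expectation (indicat_real (X i -` A i \<inter> space M))"
          by (intro Bochner_Integration.integral_cong) (auto simp: indicator_def)
        then show ?thesis by simp
      qed
      define E where "E = (\<Inter>i\<in>I. X i -` A i \<inter> space M)"
      have "E \<inter> space M = E"
        using False by (auto simp: E_def)
      then have "prob E = expectation (indicat_real E)"
        by simp
      also have "\<dots> = expectation (\<lambda>\<omega>. \<Prod>i\<in>I. indicat_real (A i) (X i \<omega>))"
      proof (rule Bochner_Integration.integral_cong[OF refl])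
        fix \<omega> assume \<omega>: "\<omega> \<in> space M"
        show "indicat_real E \<omega> = (\<Prod>i\<in>I. indicat_real (A i) (X i \<omega>))"
        proof (cases "\<forall>i\<in>I. X i \<omega> \<in> A i")
          case True
          with \<omega> show ?thesis by (simp add: E_def)
        next
          case no: False
          then have "(\<Prod>i\<in>I. indicat_real (A i) (X i \<omega>)) = 0"
            using fin by (auto simp: prod_zero_iff indicator_def)
          moreover have "\<omega> \<notin> E" using no by (auto simp: E_def)
          ultimately show ?thesis by simp
        qed
      qed
      also have "\<dots> = (\<Prod>i\<in>I. prob (X i -` A i \<inter> space M))"
        using prod[of A] A single by (auto simp: Pi_iff)
      finally show "prob (\<Inter>i\<in>I. X i -` A i \<inter> space M) = (\<Prod>i\<in>I. prob (X i -` A i \<inter> space M))"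
        by (simp only: E_def)
    qed
  qed (use False fin rv in \<open>auto intro: sets.Int_stable simp: sets.sigma_sets_eq dest: sets.sets_into_space\<close>)
qed

end

section \<open>Subordination\<close>

locale subordination = prob_space M for M :: "'w measure" +
  fixes H :: "'d::finite \<Rightarrow> 'h::{real_inner,polish_space} set"
    and L :: "'d \<Rightarrow> real \<Rightarrow> 'w \<Rightarrow> 'h"
    and \<Theta> :: "real \<Rightarrow> 'w \<Rightarrow> real ^ 'd"
  assumes L_levy: "\<And>j. levy_process M (H j) (L j)"
    and L_cadlag: "\<And>j. cadlag M (L j)"
    and L_indep: "indep_vars (\<lambda>_. trajectory_space) (\<lambda>j. trajectory (L j)) UNIV"
    and Theta_levy: "levy_process M UNIV \<Theta>"
    and Theta_cadlag: "cadlag M \<Theta>"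
    and Theta_subordinator: "\<And>j. subordinator M (\<lambda>t \<omega>. \<Theta> t \<omega> $ j)"
    and L_Theta_indep: "indep_processes (\<lambda>t. multi_eval L (\<chi> j. t)) \<Theta>"
begin

abbreviation subordinated :: "real \<Rightarrow> 'w \<Rightarrow> 'h ^ 'd"
  where "subordinated t \<omega> \<equiv> multi_eval L (\<Theta> t \<omega>) \<omega>"

lemma levy_increments_indep:
  assumes "levy_process M S X" "0 \<le> t 0" "\<And>i. i < n \<Longrightarrow> t i \<le> t (Suc i)"
  shows "indep_vars (\<lambda>_. borel) (\<lambda>i \<omega>. X (t (Suc i)) \<omega> - X (t i) \<omega>) {..<n}"
proof -
  have "\<forall>(n::nat) t. 0 \<le> t 0 \<and> (\<forall>i<n. t i \<le> t (Suc i)) \<longrightarrow>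
      indep_vars (\<lambda>_. borel) (\<lambda>i \<omega>. X (t (Suc i)) \<omega> - X (t i) \<omega>) {..<n}"
    using assms(1) unfolding levy_process_def by (elim conjE)
  from this[rule_format, of t n] assms(2,3) show ?thesis by simp
qed

lemma L_measurable: "0 \<le> t \<Longrightarrow> L j t \<in> borel_measurable M"
  using L_levy by (simp add: levy_process_def)

lemma Theta_measurable: "0 \<le> t \<Longrightarrow> \<Theta> t \<in> borel_measurable M"
  using Theta_levy by (simp add: levy_process_def)

lemma L_right_continuous:
  "\<omega> \<in> space M \<Longrightarrow> 0 \<le> t \<Longrightarrow> ((\<lambda>s. L j s \<omega>) \<longlongrightarrow> L j t \<omega>) (at_right t)"
  using L_cadlag by (simp add: cadlag_def)

lemma Theta_orthant: "\<omega> \<in> space M \<Longrightarrow> 0 \<le> t \<Longrightarrow> \<Theta> t \<omega> \<in> nonneg_orthant"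
  using Theta_subordinator by (simp add: subordinator_def nonneg_orthant_def)

lemma Theta_nonneg: "\<omega> \<in> space M \<Longrightarrow> 0 \<le> t \<Longrightarrow> 0 \<le> \<Theta> t \<omega> $ j"
  using Theta_subordinator by (simp add: subordinator_def)

lemma Theta_mono: "\<omega> \<in> space M \<Longrightarrow> 0 \<le> s \<Longrightarrow> s \<le> t \<Longrightarrow> \<Theta> s \<omega> $ j \<le> \<Theta> t \<omega> $ j"
  using Theta_subordinator by (simp add: subordinator_def)

lemma Theta_increment_orthant:
  "\<omega> \<in> space M \<Longrightarrow> 0 \<le> s \<Longrightarrow> s \<le> t \<Longrightarrow> \<Theta> t \<omega> - \<Theta> s \<omega> \<in> nonneg_orthant"
  using Theta_mono by (simp add: nonneg_orthant_def)

lemma cadlag_subordinated: "cadlag M subordinated"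
  unfolding cadlag_def
proof (intro ballI conjI allI impI)
  fix \<omega> assume \<omega>: "\<omega> \<in> space M"
  have Theta_right: "((\<lambda>s. \<Theta> s \<omega> $ j) \<longlongrightarrow> \<Theta> t \<omega> $ j) (at_right t)" if "0 \<le> t" for t j
    using Theta_cadlag \<omega> that by (intro tendsto_vec_nth) (simp add: cadlag_def)
  have Theta_left: "\<exists>l. ((\<lambda>s. \<Theta> s \<omega> $ j) \<longlongrightarrow> l) (at_left t)" if "0 < t" for t j
    using Theta_cadlag \<omega> that tendsto_vec_nth unfolding cadlag_def by blast
  have L_left: "\<exists>l. ((\<lambda>s. L j s \<omega>) \<longlongrightarrow> l) (at_left t)" if "0 < t" for t j
    using L_cadlag \<omega> that by (simp add: cadlag_def)
  have right: "((\<lambda>s. L j (\<Theta> s \<omega> $ j) \<omega>) \<longlongrightarrow> L j (\<Theta> t \<omega> $ j) \<omega>) (at_right t)" if "0 \<le> t" for t j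
    by (rule cadlag_compose_nondecreasing(1)[of "\<lambda>s. L j s \<omega>" "\<lambda>s. \<Theta> s \<omega> $ j"])
       (assumption | rule L_right_continuous[OF \<omega>] L_left Theta_nonneg[OF \<omega>] Theta_mono[OF \<omega>]
          Theta_right Theta_left that)+
  have left: "\<exists>l. ((\<lambda>s. L j (\<Theta> s \<omega> $ j) \<omega>) \<longlongrightarrow> l) (at_left t)" if "0 < t" for t j
    by (rule cadlag_compose_nondecreasing(2)[of "\<lambda>s. L j s \<omega>" "\<lambda>s. \<Theta> s \<omega> $ j"])
       (assumption | rule L_right_continuous[OF \<omega>] L_left Theta_nonneg[OF \<omega>] Theta_mono[OF \<omega>]
          Theta_right Theta_left that)+
  show "((\<lambda>s. subordinated s \<omega>) \<longlongrightarrow> subordinated t \<omega>) (at_right t)" if "0 \<le> t" for t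
    unfolding multi_eval_def by (intro tendsto_vec_lambda right that)
  show "\<exists>l. ((\<lambda>s. subordinated s \<omega>) \<longlongrightarrow> l) (at_left t)" if t: "0 < t" for t
  proof -
    obtain l where "\<And>j. ((\<lambda>s. L j (\<Theta> s \<omega> $ j) \<omega>) \<longlongrightarrow> l j) (at_left t)"
      using left[OF t] by metis
    then have "((\<lambda>s. subordinated s \<omega>) \<longlongrightarrow> (\<chi> j. l j)) (at_left t)"
      unfolding multi_eval_def by (intro tendsto_vec_lambda)
    then show ?thesis by blast
  qed
qed

abbreviation L_algebra :: "'w measure"
  where "L_algebra \<equiv> process_algebra M (\<lambda>t. multi_eval L (\<chi> j. t))"

abbreviation Theta_algebra :: "'w measure"
  where "Theta_algebra \<equiv> process_algebra M \<Theta>"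

lemma L_measurable_L_algebra:
  assumes "0 \<le> t"
  shows "L j t \<in> borel_measurable L_algebra"
  using borel_measurable_vec_component[OF measurable_process_algebra[OF assms, of "\<lambda>t. multi_eval L (\<chi> j. t)"], of j]
  by (simp add: multi_eval_def)

lemma multi_eval_measurable:
  assumes N: "space N = space M" "\<And>j t. 0 \<le> t \<Longrightarrow> L j t \<in> borel_measurable N"
    and f: "f \<in> measurable Q N" and g: "g \<in> borel_measurable Q"
  shows "(\<lambda>x. multi_eval L (nonneg_part (g x)) (f x)) \<in> borel_measurable Q"
  unfolding multi_eval_def nonneg_part_def vec_lambda_beta
proof (rule borel_measurable_vec_lambda)
  fix j
  show "(\<lambda>x. L j (max 0 (g x $ j)) (f x)) \<in> borel_measurable Q"
  proof (rule right_continuous_process_at_random_time[OF N(2)])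
    show "((\<lambda>s. L j s \<omega>) \<longlongrightarrow> L j t \<omega>) (at_right t)" if "\<omega> \<in> space N" "0 \<le> t" for \<omega> t
      using L_right_continuous that N(1) by simp
    show "f \<in> measurable Q N" by (rule f)
    show "(\<lambda>x. g x $ j) \<in> borel_measurable Q" by (rule borel_measurable_vec_component[OF g])
  qed
qed

lemma multi_eval_measurable_M:
  "\<theta> \<in> nonneg_orthant \<Longrightarrow> multi_eval L \<theta> \<in> borel_measurable M"
  unfolding multi_eval_def nonneg_orthant_def
  by (intro borel_measurable_vec_lambda L_measurable) simp

text \<open>Each column collects the increments of one \<open>L\<^sub>j\<close> along the \<open>j\<close>-th components of the times.
  The time partitions differ from column to column, which is harmless because the columns are
  functions of whole trajectories.\<close>

lemma L_increments_grid:
  assumes n: "0 < n" and \<theta>: "\<And>i. i \<le> n \<Longrightarrow> \<theta> i \<in> nonneg_orthant"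
    and mono: "\<And>i j. i < n \<Longrightarrow> \<theta> i $ j \<le> \<theta> (Suc i) $ j"
  shows "indep_vars (\<lambda>_. borel) (\<lambda>(i, j) \<omega>. L j (\<theta> (Suc i) $ j) \<omega> - L j (\<theta> i $ j) \<omega>) ({..<n} \<times> UNIV)"
proof -
  have nonneg: "0 \<le> \<theta> i $ j" if "i \<le> n" for i j
    using \<theta>[OF that] by (simp add: nonneg_orthant_def)
  define g where "g i j f = f (\<theta> (Suc i) $ j) - f (\<theta> i $ j)" for i j and f :: "real \<Rightarrow> 'h"
  have gT: "g i j (trajectory (L j) \<omega>) = L j (\<theta> (Suc i) $ j) \<omega> - L j (\<theta> i $ j) \<omega>" if "i < n" for i j \<omega>
    using nonneg[of i j] nonneg[of "Suc i" j] that by (simp add: g_def trajectory_def)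
  have "indep_vars (\<lambda>_. borel) (\<lambda>(i, j) \<omega>. g i j (trajectory (L j) \<omega>)) ({..<n} \<times> UNIV)"
  proof (rule indep_vars_grid[OF _ _ _ _ L_indep])
    show "g i j \<in> borel_measurable trajectory_space" if "i \<in> {..<n}" for i j
      unfolding g_def using nonneg[of i j] nonneg[of "Suc i" j] that
      by (intro borel_measurable_diff measurable_component_singleton) auto
    show "indep_vars (\<lambda>_. borel) (\<lambda>i \<omega>. g i j (trajectory (L j) \<omega>)) {..<n}" for j
    proof -
      have "indep_vars (\<lambda>_. borel) (\<lambda>i \<omega>. L j (\<theta> (Suc i) $ j) \<omega> - L j (\<theta> i $ j) \<omega>) {..<n}"
        using levy_increments_indep[OF L_levy, of "\<lambda>i. \<theta> i $ j"] nonneg[of 0 j] mono by simp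
      then show ?thesis
        by (rule indep_vars_cong[THEN iffD1, rotated 3]) (auto simp: gT)
    qed
  qed (use n in auto)
  then show ?thesis
    by (rule indep_vars_cong[THEN iffD1, rotated 3]) (auto simp: gT)
qed

lemma multi_eval_L_increments_indep:
  assumes \<theta>: "\<And>i. i \<le> n \<Longrightarrow> \<theta> i \<in> nonneg_orthant"
    and mono: "\<And>i j. i < n \<Longrightarrow> \<theta> i $ j \<le> \<theta> (Suc i) $ j"
  shows "indep_vars (\<lambda>_. borel) (\<lambda>i \<omega>. multi_eval L (\<theta> (Suc i)) \<omega> - multi_eval L (\<theta> i) \<omega>) {..<n}"
proof (cases "n = 0")
  case True
  then show ?thesis by (simp add: indep_vars_def indep_sets_def)
next
  case False
  then have "indep_vars (\<lambda>_. borel) (\<lambda>i \<omega>. \<chi> j. L j (\<theta> (Suc i) $ j) \<omega> - L j (\<theta> i $ j) \<omega>) {..<n}"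
    using indep_vars_vec_of_grid[OF L_increments_grid] assms by simp
  then show ?thesis
    by (rule indep_vars_cong[THEN iffD1, rotated 3]) (auto simp: multi_eval_def vec_eq_iff fun_eq_iff)
qed

lemma L_increments_components_indep:
  assumes "\<theta> \<in> nonneg_orthant" "\<theta>' - \<theta> \<in> nonneg_orthant"
  shows "indep_vars (\<lambda>_. borel) (\<lambda>j \<omega>. L j (\<theta>' $ j) \<omega> - L j (\<theta> $ j) \<omega>) UNIV"
proof -
  have nonneg: "0 \<le> \<theta> $ j" "0 \<le> \<theta>' $ j" for j
    using assms by (auto simp: nonneg_orthant_def) (meson order_trans)
  define g where "g j f = f (\<theta>' $ j) - f (\<theta> $ j)" for j and f :: "real \<Rightarrow> 'h"
  have "indep_vars (\<lambda>_. borel) (\<lambda>j \<omega>. g j (trajectory (L j) \<omega>)) UNIV"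
    by (rule indep_vars_compose2[OF L_indep])
       (use nonneg in \<open>auto simp: g_def intro!: borel_measurable_diff measurable_component_singleton\<close>)
  then show ?thesis
    using nonneg by (simp add: g_def trajectory_def)
qed

lemma multi_eval_L_increment_distr:
  assumes "\<theta> \<in> nonneg_orthant" "\<theta>' - \<theta> \<in> nonneg_orthant"
  shows "distr M borel (\<lambda>\<omega>. multi_eval L \<theta>' \<omega> - multi_eval L \<theta> \<omega>)
    = distr M borel (\<lambda>\<omega>. multi_eval L (\<theta>' - \<theta>) \<omega> - multi_eval L 0 \<omega>)"
proof -
  have zero: "(0 :: real ^ 'd) \<in> nonneg_orthant" by (simp add: nonneg_orthant_def)
  have "distr M borel (\<lambda>\<omega>. L j (\<theta>' $ j) \<omega> - L j (\<theta> $ j) \<omega>)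
      = distr M borel (\<lambda>\<omega>. L j ((\<theta>' - \<theta>) $ j) \<omega> - L j ((0 :: real ^ 'd) $ j) \<omega>)" for j
  proof -
    have "\<forall>s\<ge>0. \<forall>t\<ge>0. distr M borel (\<lambda>\<omega>. L j (s + t) \<omega> - L j s \<omega>) = distr M borel (\<lambda>\<omega>. L j t \<omega> - L j 0 \<omega>)"
      using L_levy[of j] unfolding levy_process_def by blast
    from this[rule_format, of "\<theta> $ j" "(\<theta>' - \<theta>) $ j"] assms show ?thesis
      by (simp add: nonneg_orthant_def)
  qed
  then have "distr M borel (\<lambda>\<omega>. \<chi> j. L j (\<theta>' $ j) \<omega> - L j (\<theta> $ j) \<omega>)
      = distr M borel (\<lambda>\<omega>. \<chi> j. L j ((\<theta>' - \<theta>) $ j) \<omega> - L j ((0 :: real ^ 'd) $ j) \<omega>)"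
    using assms zero by (intro distr_vec_cong L_increments_components_indep) simp_all
  moreover have "(\<chi> j. L j (\<theta> $ j) \<omega> - L j (\<theta>' $ j) \<omega>) = multi_eval L \<theta> \<omega> - multi_eval L \<theta>' \<omega>" for \<theta> \<theta>' \<omega>
    by (simp add: multi_eval_def vec_eq_iff)
  ultimately show ?thesis by (simp only:)
qed

text \<open>The function \<open>\<theta> \<mapsto> E g(L(\<theta>) - L(0))\<close>, that is, the semigroup of the \<open>d\<close>-parameter process \<open>L\<close>
  applied to \<open>g\<close> and evaluated at the origin.\<close>

definition averaged :: "('h ^ 'd \<Rightarrow> 'b) \<Rightarrow> real ^ 'd \<Rightarrow> 'b::{banach,second_countable_topology}"
  where "averaged g \<theta> = expectation (\<lambda>\<omega>. g (multi_eval L (nonneg_part \<theta>) \<omega> - multi_eval L 0 \<omega>))"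

lemma averaged_measurable:
  fixes g :: "'h ^ 'd \<Rightarrow> 'b::{banach,second_countable_topology}"
  assumes [measurable]: "g \<in> borel_measurable borel"
  shows "averaged g \<in> borel_measurable borel"
proof -
  have 1: "(\<lambda>(\<theta>, \<omega>). multi_eval L (nonneg_part \<theta>) \<omega>) \<in> borel_measurable (borel \<Otimes>\<^sub>M M)"
    unfolding case_prod_beta by (rule multi_eval_measurable[OF refl L_measurable]) measurable
  have [measurable]: "multi_eval L 0 \<in> borel_measurable M"
    by (rule multi_eval_measurable_M) (simp add: nonneg_orthant_def)
  have 2: "(\<lambda>(\<theta> :: real ^ 'd, \<omega>). g (multi_eval L (nonneg_part \<theta>) \<omega> - multi_eval L 0 \<omega>)) \<in> borel_measurable (borel \<Otimes>\<^sub>M M)"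
    using 1 unfolding case_prod_beta by measurable
  then show ?thesis
    unfolding averaged_def[abs_def] by (rule borel_measurable_lebesgue_integral)
qed

lemma averaged_norm_le:
  assumes "\<And>x. norm (g x) \<le> 1"
  shows "norm (averaged g \<theta>) \<le> 1"
proof (cases "integrable M (\<lambda>\<omega>. g (multi_eval L (nonneg_part \<theta>) \<omega> - multi_eval L 0 \<omega>))")
  case True
  have "norm (averaged g \<theta>)
      \<le> expectation (\<lambda>\<omega>. norm (g (multi_eval L (nonneg_part \<theta>) \<omega> - multi_eval L 0 \<omega>)))"
    unfolding averaged_def by (rule Bochner_Integration.integral_norm_bound)
  also have "\<dots> \<le> 1"
    by (rule integral_le_const[OF integrable_norm[OF True]]) (simp add: assms)
  finally show ?thesis .
qed (simp add: averaged_def not_integrable_integral_eq)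

text \<open>The values of \<open>\<Theta>\<close> are frozen. What is left is an expectation over increments of \<open>L\<close> along a
  deterministic increasing chain of times; it factorizes, and each factor depends only on the
  difference of two successive times.\<close>

lemma expectation_prod_increments:
  fixes g :: "nat \<Rightarrow> 'h ^ 'd \<Rightarrow> 'b::{real_normed_field,banach,second_countable_topology}"
  assumes t: "0 \<le> t 0" "\<And>i. i < n \<Longrightarrow> t i \<le> t (Suc i)"
    and g: "\<And>i. i < n \<Longrightarrow> g i \<in> borel_measurable borel" "\<And>i x. i < n \<Longrightarrow> norm (g i x) \<le> 1"
  shows "expectation (\<lambda>\<omega>. \<Prod>i<n. g i (subordinated (t (Suc i)) \<omega> - subordinated (t i) \<omega>))
    = expectation (\<lambda>\<omega>. \<Prod>i<n. averaged (g i) (\<Theta> (t (Suc i)) \<omega> - \<Theta> (t i) \<omega>))"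
proof -
  have t_nonneg: "0 \<le> t i" if "i \<le> n" for i
    using that by (induction i) (use t in \<open>auto intro: order_trans\<close>)
  define f where "f = (\<lambda>(\<omega>, \<omega>'). \<Prod>i<n. g i (multi_eval L (nonneg_part (\<Theta> (t (Suc i)) \<omega>')) \<omega>
      - multi_eval L (nonneg_part (\<Theta> (t i) \<omega>')) \<omega>))"
  have eval: "(\<lambda>x. multi_eval L (nonneg_part (\<Theta> (t i) (snd x))) (fst x)) \<in> borel_measurable (L_algebra \<Otimes>\<^sub>M Theta_algebra)"
    if "i \<le> n" for i
    using measurable_process_algebra[OF t_nonneg[OF that], of \<Theta> M]
    by (intro multi_eval_measurable[OF _ L_measurable_L_algebra]) auto
  have "expectation (\<lambda>\<omega>. \<Prod>i<n. g i (subordinated (t (Suc i)) \<omega> - subordinated (t i) \<omega>))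
      = expectation (\<lambda>\<omega>. f (\<omega>, \<omega>))"
    using Theta_orthant t_nonneg
    by (intro Bochner_Integration.integral_cong prod.cong) (auto simp: f_def nonneg_part_eq)
  also have "\<dots> = expectation (\<lambda>\<omega>'. expectation (\<lambda>\<omega>. f (\<omega>, \<omega>')))"
  proof (rule freezing)
    show "indep_set (sets L_algebra) (sets Theta_algebra)"
      using L_Theta_indep by (simp add: indep_processes_def)
    show "f \<in> borel_measurable (L_algebra \<Otimes>\<^sub>M Theta_algebra)"
      unfolding f_def case_prod_beta
      by (intro borel_measurable_prod measurable_compose[OF _ g(1)] borel_measurable_diff eval) auto
    show "norm (f x) \<le> 1" for x
      unfolding f_def case_prod_beta using g(2)
      by (auto simp: prod_norm[symmetric] intro!: prod_le_1)
  qed simp_all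
  also have "\<dots> = expectation (\<lambda>\<omega>'. \<Prod>i<n. averaged (g i) (\<Theta> (t (Suc i)) \<omega>' - \<Theta> (t i) \<omega>'))"
  proof (rule Bochner_Integration.integral_cong[OF refl])
    fix \<omega>' assume \<omega>': "\<omega>' \<in> space M"
    define \<theta> where "\<theta> i = \<Theta> (t i) \<omega>'" for i
    have \<theta>: "\<theta> i \<in> nonneg_orthant" if "i \<le> n" for i
      unfolding \<theta>_def by (rule Theta_orthant[OF \<omega>' t_nonneg[OF that]])
    have \<theta>_incr: "\<theta> (Suc i) - \<theta> i \<in> nonneg_orthant" if "i < n" for i
      unfolding \<theta>_def using that t(2) t_nonneg by (intro Theta_increment_orthant[OF \<omega>']) auto
    let ?D = "\<lambda>i \<omega>. multi_eval L (\<theta> (Suc i)) \<omega> - multi_eval L (\<theta> i) \<omega>"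
    have indep: "indep_vars (\<lambda>_. borel) ?D {..<n}"
      using \<theta> \<theta>_incr by (intro multi_eval_L_increments_indep) (auto simp: nonneg_orthant_def)
    have gD: "indep_vars (\<lambda>_. borel) (\<lambda>i \<omega>. g i (?D i \<omega>)) {..<n}"
      by (rule indep_vars_compose2[OF indep]) (use g in auto)
    have D_meas: "?D i \<in> borel_measurable M" if "i < n" for i
      using indep that by (auto simp: indep_vars_def)
    have "expectation (\<lambda>\<omega>. f (\<omega>, \<omega>')) = expectation (\<lambda>\<omega>. \<Prod>i<n. g i (?D i \<omega>))"
      using \<theta> by (intro Bochner_Integration.integral_cong prod.cong)
        (auto simp: f_def nonneg_part_eq \<theta>_def[symmetric])
    also have "\<dots> = (\<Prod>i<n. expectation (\<lambda>\<omega>. g i (?D i \<omega>)))"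
    proof (rule indep_vars_lebesgue_integral[OF _ gD])
      show "integrable M (\<lambda>\<omega>. g i (?D i \<omega>))" if "i \<in> {..<n}" for i
        using that g D_meas by (intro integrable_const_bound[where B = 1] measurable_compose[OF _ g(1)]) auto
    qed simp
    also have "\<dots> = (\<Prod>i<n. averaged (g i) (\<theta> (Suc i) - \<theta> i))"
    proof (rule prod.cong[OF refl])
      fix i assume "i \<in> {..<n}"
      then have i: "i < n" by simp
      have 0: "(0 :: real ^ 'd) \<in> nonneg_orthant" by (simp add: nonneg_orthant_def)
      have "expectation (\<lambda>\<omega>. g i (?D i \<omega>)) = (LINT x|distr M borel (?D i). g i x)"
        using g(1) i D_meas by (intro integral_distr[symmetric]) auto
      also have "\<dots> = (LINT x|distr M borel (\<lambda>\<omega>. multi_eval L (\<theta> (Suc i) - \<theta> i) \<omega> - multi_eval L 0 \<omega>). g i x)"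
        using \<theta> \<theta>_incr i by (subst multi_eval_L_increment_distr) auto
      also have "\<dots> = expectation (\<lambda>\<omega>. g i (multi_eval L (\<theta> (Suc i) - \<theta> i) \<omega> - multi_eval L 0 \<omega>))"
        using g(1) i \<theta>_incr 0
        by (intro integral_distr borel_measurable_diff multi_eval_measurable_M) auto
      also have "\<dots> = averaged (g i) (\<theta> (Suc i) - \<theta> i)"
        using \<theta>_incr[OF i] by (simp add: averaged_def nonneg_part_eq)
      finally show "expectation (\<lambda>\<omega>. g i (?D i \<omega>)) = averaged (g i) (\<theta> (Suc i) - \<theta> i)" .
    qed
    finally show "expectation (\<lambda>\<omega>. f (\<omega>, \<omega>')) = (\<Prod>i<n. averaged (g i) (\<Theta> (t (Suc i)) \<omega>' - \<Theta> (t i) \<omega>'))"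
      by (simp add: \<theta>_def)
  qed
  finally show ?thesis .
qed

lemma expectation_increment:
  fixes g :: "'h ^ 'd \<Rightarrow> 'b::{real_normed_field,banach,second_countable_topology}"
  assumes "0 \<le> s" "s \<le> t" "g \<in> borel_measurable borel" "\<And>x. norm (g x) \<le> 1"
  shows "expectation (\<lambda>\<omega>. g (subordinated t \<omega> - subordinated s \<omega>))
    = expectation (\<lambda>\<omega>. averaged g (\<Theta> t \<omega> - \<Theta> s \<omega>))"
  using expectation_prod_increments[of "\<lambda>i. if i = 0 then s else t" "Suc 0" "\<lambda>_. g"] assms by simp

lemma subordinated_measurable:
  assumes "0 \<le> t"
  shows "subordinated t \<in> borel_measurable M"
proof -
  have "(\<lambda>\<omega>. multi_eval L (nonneg_part (\<Theta> t \<omega>)) \<omega>) \<in> borel_measurable M"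
    by (rule multi_eval_measurable[OF refl L_measurable _ Theta_measurable]) (use assms in auto)
  then show ?thesis
    by (rule measurable_cong[THEN iffD1, rotated]) (use assms Theta_orthant in \<open>simp add: nonneg_part_eq\<close>)
qed

text \<open>For indicator functions the averaged functions of the increments of \<open>\<Theta>\<close> are independent, so the
  expectation of their product factorizes; the case of a single increment, read backwards,
  identifies the factors.\<close>

lemma subordinated_increments_indep:
  assumes t: "0 \<le> t 0" "\<And>i. i < n \<Longrightarrow> t i \<le> t (Suc i)"
  shows "indep_vars (\<lambda>_. borel) (\<lambda>i \<omega>. subordinated (t (Suc i)) \<omega> - subordinated (t i) \<omega>) {..<n}"
proof (rule indep_varsI_expectation)
  have t_nonneg: "0 \<le> t i" if "i \<le> n" for i
    using that by (induction i) (use t in \<open>auto intro: order_trans\<close>)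
  show "(\<lambda>\<omega>. subordinated (t (Suc i)) \<omega> - subordinated (t i) \<omega>) \<in> borel_measurable M" if "i \<in> {..<n}" for i
    using that t_nonneg by (intro borel_measurable_diff subordinated_measurable) auto
  fix A :: "nat \<Rightarrow> ('h ^ 'd) set" assume A: "\<And>i. i \<in> {..<n} \<Longrightarrow> A i \<in> sets borel"
  have A_le: "norm (indicat_real (A i) x) \<le> 1" for i x by (simp add: indicator_def)
  have Theta_indep: "indep_vars (\<lambda>_. borel) (\<lambda>i \<omega>. \<Theta> (t (Suc i)) \<omega> - \<Theta> (t i) \<omega>) {..<n}"
    using levy_increments_indep[OF Theta_levy t] .
  have indep: "indep_vars (\<lambda>_. borel) (\<lambda>i \<omega>. averaged (indicat_real (A i)) (\<Theta> (t (Suc i)) \<omega> - \<Theta> (t i) \<omega>)) {..<n}"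
    by (rule indep_vars_compose2[OF Theta_indep averaged_measurable]) (use A in auto)
  have averaged_le: "norm (averaged (indicat_real (A i)) \<theta>) \<le> 1" for i \<theta>
    by (rule averaged_norm_le) (rule A_le)
  have "expectation (\<lambda>\<omega>. \<Prod>i<n. indicat_real (A i) (subordinated (t (Suc i)) \<omega> - subordinated (t i) \<omega>))
      = expectation (\<lambda>\<omega>. \<Prod>i<n. averaged (indicat_real (A i)) (\<Theta> (t (Suc i)) \<omega> - \<Theta> (t i) \<omega>))"
    by (rule expectation_prod_increments) (use t A A_le in auto)
  also have "\<dots> = (\<Prod>i<n. expectation (\<lambda>\<omega>. averaged (indicat_real (A i)) (\<Theta> (t (Suc i)) \<omega> - \<Theta> (t i) \<omega>)))"
  proof (rule indep_vars_lebesgue_integral[OF _ indep])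
    show "integrable M (\<lambda>\<omega>. averaged (indicat_real (A i)) (\<Theta> (t (Suc i)) \<omega> - \<Theta> (t i) \<omega>))" if "i \<in> {..<n}" for i
      using that indep averaged_le by (intro integrable_const_bound[where B = 1]) (auto simp: indep_vars_def)
  qed simp
  also have "\<dots> = (\<Prod>i<n. expectation (\<lambda>\<omega>. indicat_real (A i) (subordinated (t (Suc i)) \<omega> - subordinated (t i) \<omega>)))"
    using t t_nonneg A A_le by (intro prod.cong refl expectation_increment[symmetric]) auto
  finally show "expectation (\<lambda>\<omega>. \<Prod>i<n. indicat_real (A i) (subordinated (t (Suc i)) \<omega> - subordinated (t i) \<omega>)) = \<dots>" .
qed simp

lemma subordinated_stationary:
  assumes "0 \<le> s" "0 \<le> t"
  shows "distr M borel (\<lambda>\<omega>. subordinated (s + t) \<omega> - subordinated s \<omega>)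
    = distr M borel (\<lambda>\<omega>. subordinated t \<omega> - subordinated 0 \<omega>)"
proof (rule measure_eqI)
  have meas: "(\<lambda>\<omega>. subordinated v \<omega> - subordinated u \<omega>) \<in> borel_measurable M" if "0 \<le> u" "0 \<le> v" for u v
    using that by (intro borel_measurable_diff subordinated_measurable)
  have Theta_meas: "(\<lambda>\<omega>. \<Theta> v \<omega> - \<Theta> u \<omega>) \<in> borel_measurable M" if "0 \<le> u" "0 \<le> v" for u v
    using that by (intro borel_measurable_diff Theta_measurable)
  fix B assume "B \<in> sets (distr M borel (\<lambda>\<omega>. subordinated (s + t) \<omega> - subordinated s \<omega>))"
  then have B: "B \<in> sets borel" by simp
  have law: "emeasure (distr M borel (\<lambda>\<omega>. subordinated v \<omega> - subordinated u \<omega>)) B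
      = ennreal (LINT \<theta>|distr M borel (\<lambda>\<omega>. \<Theta> v \<omega> - \<Theta> u \<omega>). averaged (indicat_real B) \<theta>)"
    if uv: "0 \<le> u" "u \<le> v" for u v
  proof -
    interpret D: prob_space "distr M borel (\<lambda>\<omega>. subordinated v \<omega> - subordinated u \<omega>)"
      using meas uv by (intro prob_space_distr) auto
    have "D.prob B = (LINT x|distr M borel (\<lambda>\<omega>. subordinated v \<omega> - subordinated u \<omega>). indicat_real B x)"
      by simp
    also have "\<dots> = expectation (\<lambda>\<omega>. indicat_real B (subordinated v \<omega> - subordinated u \<omega>))"
      using meas uv B by (intro integral_distr) auto
    also have "\<dots> = expectation (\<lambda>\<omega>. averaged (indicat_real B) (\<Theta> v \<omega> - \<Theta> u \<omega>))"
      using uv B by (intro expectation_increment) (auto simp: indicator_def)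
    also have "\<dots> = (LINT \<theta>|distr M borel (\<lambda>\<omega>. \<Theta> v \<omega> - \<Theta> u \<omega>). averaged (indicat_real B) \<theta>)"
      using Theta_meas uv B by (intro integral_distr[symmetric] averaged_measurable) auto
    finally show ?thesis
      by (simp add: D.emeasure_eq_measure)
  qed
  have "distr M borel (\<lambda>\<omega>. \<Theta> (s + t) \<omega> - \<Theta> s \<omega>) = distr M borel (\<lambda>\<omega>. \<Theta> t \<omega> - \<Theta> 0 \<omega>)"
    using Theta_levy assms unfolding levy_process_def by blast
  then show "emeasure (distr M borel (\<lambda>\<omega>. subordinated (s + t) \<omega> - subordinated s \<omega>)) B
      = emeasure (distr M borel (\<lambda>\<omega>. subordinated t \<omega> - subordinated 0 \<omega>)) B"
    using assms by (simp add: law)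
qed simp

lemma subordinated_zero: "AE \<omega> in M. subordinated 0 \<omega> = 0"
proof -
  have "AE \<omega> in M. \<forall>j. L j 0 \<omega> = 0"
    using L_levy by (intro AE_all_countable[THEN iffD2] allI) (simp add: levy_process_def)
  moreover have "AE \<omega> in M. \<Theta> 0 \<omega> = 0"
    using Theta_levy by (simp add: levy_process_def)
  ultimately show ?thesis
    by eventually_elim (simp add: multi_eval_def vec_eq_iff)
qed


lemma subordinated_continuous_at_zero_in_probability:
  assumes "0 < \<epsilon>"
  shows "((\<lambda>h. prob {\<omega> \<in> space M. \<epsilon> < norm (subordinated h \<omega> - subordinated 0 \<omega>)}) \<longlongrightarrow> 0) (at_right 0)"
  unfolding tendsto_at_iff_sequentially comp_def
proof safe
  fix h :: "nat \<Rightarrow> real" assume h: "\<forall>i. h i \<in> {0<..} - {0}" and h_lim: "h \<longlonglongrightarrow> 0"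
  have h_pos: "0 < h i" for i using h by simp
  define E where "E i = {\<omega> \<in> space M. \<epsilon> < norm (subordinated (h i) \<omega> - subordinated 0 \<omega>)}" for i
  have E_meas: "E i \<in> events" for i
  proof -
    have [measurable]: "(\<lambda>\<omega>. subordinated (h i) \<omega> - subordinated 0 \<omega>) \<in> borel_measurable M"
      using h_pos[of i] by (intro borel_measurable_diff subordinated_measurable) auto
    show ?thesis unfolding E_def by measurable
  qed
  have "(\<lambda>i. expectation (indicat_real (E i))) \<longlonglongrightarrow> expectation (\<lambda>_. 0)"
  proof (rule integral_dominated_convergence[where w = "\<lambda>_. 1"])
    show "AE \<omega> in M. (\<lambda>i. indicat_real (E i) \<omega>) \<longlonglongrightarrow> 0"
    proof (rule AE_I2)
      fix \<omega> assume \<omega>: "\<omega> \<in> space M"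
      have h_right: "filterlim h (at_right 0) sequentially"
        using h_lim h_pos by (auto simp: filterlim_at intro!: always_eventually) (metis less_irrefl)
      have "((\<lambda>s. subordinated s \<omega>) \<longlongrightarrow> subordinated 0 \<omega>) (at_right 0)"
        using cadlag_subordinated \<omega> by (simp add: cadlag_def)
      from filterlim_compose[OF this h_right]
      have "eventually (\<lambda>i. dist (subordinated (h i) \<omega>) (subordinated 0 \<omega>) < \<epsilon>) sequentially"
        using assms by (rule tendstoD)
      then have "eventually (\<lambda>i. indicat_real (E i) \<omega> = 0) sequentially"
        by eventually_elim (simp add: E_def dist_norm)
      then show "(\<lambda>i. indicat_real (E i) \<omega>) \<longlonglongrightarrow> 0"
        by (rule tendsto_eventually)
    qed
  qed (use E_meas in \<open>auto simp: indicator_def\<close>)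
  moreover have "expectation (indicat_real (E i)) = prob (E i)" for i
    using sets.sets_into_space[OF E_meas[of i]] by (simp add: Int_absorb2)
  ultimately show "(\<lambda>i. prob {\<omega> \<in> space M. \<epsilon> < norm (subordinated (h i) \<omega> - subordinated 0 \<omega>)}) \<longlonglongrightarrow> 0"
    by (simp add: E_def)
qed

text \<open>By stationarity the probability in question depends on \<open>\<bar>s - t\<bar>\<close> only. Thus right continuity of the
  paths at 0 suffices, also for \<open>s\<close> tending to \<open>t\<close> from the left.\<close>

lemma subordinated_continuous_in_probability:
  assumes t: "0 \<le> t" and \<epsilon>: "0 < \<epsilon>"
  shows "((\<lambda>s. prob {\<omega> \<in> space M. \<epsilon> < norm (subordinated s \<omega> - subordinated t \<omega>)}) \<longlongrightarrow> 0) (at t within {0..})"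
proof -
  define p where "p h = prob {\<omega> \<in> space M. \<epsilon> < norm (subordinated h \<omega> - subordinated 0 \<omega>)}" for h
  have incr: "prob {\<omega> \<in> space M. \<epsilon> < norm (subordinated v \<omega> - subordinated u \<omega>)} = p (v - u)"
    if uv: "0 \<le> u" "u \<le> v" for u v
  proof -
    have B: "{x :: 'h ^ 'd. \<epsilon> < norm x} \<in> sets borel" by measurable
    have law: "measure (distr M borel (\<lambda>\<omega>. subordinated v \<omega> - subordinated u \<omega>)) {x. \<epsilon> < norm x}
        = prob {\<omega> \<in> space M. \<epsilon> < norm (subordinated v \<omega> - subordinated u \<omega>)}"
      if "0 \<le> u" "0 \<le> v" for u v
      using that B
      by (subst measure_distr) (auto intro!: borel_measurable_diff subordinated_measurable arg_cong[where f = prob])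
    show ?thesis
      using law[of u v] law[of 0 "v - u"] subordinated_stationary[of u "v - u"] uv by (simp add: p_def)
  qed
  have eq: "prob {\<omega> \<in> space M. \<epsilon> < norm (subordinated s \<omega> - subordinated t \<omega>)} = p \<bar>s - t\<bar>" if "0 \<le> s" for s
    using incr[of t s] incr[of s t] t that by (cases "t \<le> s") (auto simp: norm_minus_commute)
  have "p 0 = 0" using \<epsilon> by (simp add: p_def)
  moreover have "(p \<longlongrightarrow> 0) (at_right 0)"
    using subordinated_continuous_at_zero_in_probability[OF \<epsilon>] unfolding p_def[abs_def] .
  ultimately have "continuous (at 0 within {0..}) p"
    by (simp add: continuous_within at_within_Ici_at_right)
  then have "((\<lambda>s. p \<bar>s - t\<bar>) \<longlongrightarrow> p 0) (at t within {0..})"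
  proof (rule continuous_within_tendsto_compose)
    have "((\<lambda>s. \<bar>s - t\<bar>) \<longlongrightarrow> \<bar>t - t\<bar>) (at t within {0..})"
      by (intro tendsto_intros)
    then show "((\<lambda>s. \<bar>s - t\<bar>) \<longlongrightarrow> 0) (at t within {0..})" by simp
  qed simp
  then have "((\<lambda>s. p \<bar>s - t\<bar>) \<longlongrightarrow> 0) (at t within {0..})"
    using \<open>p 0 = 0\<close> by simp
  then show ?thesis
  proof (rule Lim_transform_eventually)
    show "\<forall>\<^sub>F s in at t within {0..}. p \<bar>s - t\<bar> = prob {\<omega> \<in> space M. \<epsilon> < norm (subordinated s \<omega> - subordinated t \<omega>)}"
      using eq by (auto simp: eventually_at_filter intro!: always_eventually)
  qed
qed

theorem levy_process_subordinated: "levy_process M (hilbert_prod H) subordinated"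
  unfolding levy_process_def
proof (intro conjI allI impI ballI)
  show "subordinated t \<omega> \<in> hilbert_prod H" if "0 \<le> t" "\<omega> \<in> space M" for t \<omega>
    using L_levy Theta_nonneg that by (simp add: hilbert_prod_def multi_eval_def levy_process_def)
qed (auto intro: subordinated_measurable subordinated_zero subordinated_increments_indep
      subordinated_stationary subordinated_continuous_in_probability)

text \<open>The exponential turns the inner product on the product space into a product over the independent
  components, each of which contributes its own Levy exponent at time \<open>\<theta>\<^sub>j\<close>.\<close>

lemma averaged_iexp:
  assumes exponent: "\<And>j. has_levy_exponent M (H j) (L j) (\<phi> j)"
    and u: "u \<in> hilbert_prod H" and \<theta>: "\<theta> \<in> nonneg_orthant"
  shows "averaged (\<lambda>x. iexp (inner x u)) \<theta> = exp (\<Sum>j\<in>UNIV. \<phi> j (u $ j) * of_real (\<theta> $ j))"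
proof -
  have \<theta>_nonneg: "0 \<le> \<theta> $ j" for j
    using \<theta> by (simp add: nonneg_orthant_def)
  have L_zero: "AE \<omega> in M. \<forall>j. L j 0 \<omega> = 0"
    using L_levy by (intro AE_all_countable[THEN iffD2] allI) (simp add: levy_process_def)
  have "indep_vars (\<lambda>_. borel) (\<lambda>j \<omega>. L j (\<theta> $ j) \<omega> - L j ((0 :: real ^ 'd) $ j) \<omega>) UNIV"
    using \<theta> by (intro L_increments_components_indep) (simp_all add: nonneg_orthant_def)
  then have D: "indep_vars (\<lambda>_. borel) (\<lambda>j \<omega>. L j (\<theta> $ j) \<omega> - L j 0 \<omega>) UNIV" by simp
  have indep: "indep_vars (\<lambda>_. borel) (\<lambda>j \<omega>. iexp (inner (L j (\<theta> $ j) \<omega> - L j 0 \<omega>) (u $ j))) UNIV"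
    by (rule indep_vars_compose2[OF D]) measurable
  have "averaged (\<lambda>x. iexp (inner x u)) \<theta>
      = expectation (\<lambda>\<omega>. \<Prod>j\<in>UNIV. iexp (inner (L j (\<theta> $ j) \<omega> - L j 0 \<omega>) (u $ j)))"
    unfolding averaged_def nonneg_part_eq[OF \<theta>]
    by (simp add: multi_eval_def inner_vec_def sum_distrib_left exp_sum)
  also have "\<dots> = (\<Prod>j\<in>UNIV. expectation (\<lambda>\<omega>. iexp (inner (L j (\<theta> $ j) \<omega> - L j 0 \<omega>) (u $ j))))"
  proof (rule indep_vars_lebesgue_integral[OF _ indep])
    show "integrable M (\<lambda>\<omega>. iexp (inner (L j (\<theta> $ j) \<omega> - L j 0 \<omega>) (u $ j)))" for j
      using indep by (intro integrable_const_bound[where B = 1]) (auto simp: indep_vars_def)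
  qed simp
  also have "\<dots> = (\<Prod>j\<in>UNIV. exp (of_real (\<theta> $ j) * \<phi> j (u $ j)))"
  proof (rule prod.cong[OF refl])
    fix j
    have meas: "L j (\<theta> $ j) \<in> borel_measurable M" "L j 0 \<in> borel_measurable M"
      using L_measurable \<theta>_nonneg by auto
    have "expectation (\<lambda>\<omega>. iexp (inner (L j (\<theta> $ j) \<omega> - L j 0 \<omega>) (u $ j)))
        = expectation (\<lambda>\<omega>. iexp (inner (L j (\<theta> $ j) \<omega>) (u $ j)))"
      using meas L_zero by (intro integral_cong_AE) auto
    also have "\<dots> = exp (of_real (\<theta> $ j) * \<phi> j (u $ j))"
      using exponent[of j] \<theta>_nonneg u unfolding has_levy_exponent_def hilbert_prod_def by blast
    finally show "expectation (\<lambda>\<omega>. iexp (inner (L j (\<theta> $ j) \<omega> - L j 0 \<omega>) (u $ j))) = \<dots>" .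
  qed
  also have "\<dots> = exp (\<Sum>j\<in>UNIV. \<phi> j (u $ j) * of_real (\<theta> $ j))"
    by (simp add: exp_sum mult.commute)
  finally show ?thesis .
qed

lemma characteristic_function_subordinated:
  assumes exponent: "\<And>j. has_levy_exponent M (H j) (L j) (\<phi> j)"
    and u: "u \<in> hilbert_prod H" and t: "0 \<le> t"
  shows "expectation (\<lambda>\<omega>. iexp (inner (subordinated t \<omega>) u))
    = expectation (\<lambda>\<omega>. exp (\<Sum>j\<in>UNIV. \<phi> j (u $ j) * of_real (\<Theta> t \<omega> $ j)))"
proof -
  define g :: "'h ^ 'd \<Rightarrow> complex" where "g x = iexp (inner x u)" for x
  have g [measurable]: "g \<in> borel_measurable borel"
    unfolding g_def by measurable
  have [measurable]: "subordinated t \<in> borel_measurable M" "subordinated 0 \<in> borel_measurable M"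
    "\<Theta> t \<in> borel_measurable M" "\<Theta> 0 \<in> borel_measurable M" "averaged g \<in> borel_measurable borel"
    using t by (auto intro: subordinated_measurable Theta_measurable averaged_measurable g)
  have Theta_zero: "AE \<omega> in M. \<Theta> 0 \<omega> = 0"
    using Theta_levy by (simp add: levy_process_def)
  have "expectation (\<lambda>\<omega>. g (subordinated t \<omega>)) = expectation (\<lambda>\<omega>. g (subordinated t \<omega> - subordinated 0 \<omega>))"
    using subordinated_zero by (intro integral_cong_AE) auto
  also have "\<dots> = expectation (\<lambda>\<omega>. averaged g (\<Theta> t \<omega> - \<Theta> 0 \<omega>))"
    using t g by (intro expectation_increment) (auto simp: g_def)
  also have "\<dots> = expectation (\<lambda>\<omega>. averaged g (\<Theta> t \<omega>))"
    using Theta_zero by (intro integral_cong_AE) auto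
  also have "\<dots> = expectation (\<lambda>\<omega>. exp (\<Sum>j\<in>UNIV. \<phi> j (u $ j) * of_real (\<Theta> t \<omega> $ j)))"
    unfolding g_def
    by (intro Bochner_Integration.integral_cong averaged_iexp[OF exponent u] Theta_orthant t refl)
  finally show ?thesis by (simp add: g_def)
qed

text \<open>Characteristic functions are bounded by 1. This places the values of the exponents in the domain
  on which the Laplace transform of a nonnegative random vector converges.\<close>

lemma Re_levy_exponent_nonpos:
  assumes "has_levy_exponent M S X \<phi>" "u \<in> S"
  shows "Re (\<phi> u) \<le> 0"
proof -
  have "norm (exp (\<phi> u)) = norm (expectation (\<lambda>\<omega>. iexp (inner (X 1 \<omega>) u)))"
    using assms unfolding has_levy_exponent_def by (metis mult_1 of_real_1 zero_le_one)
  also have "\<dots> \<le> expectation (\<lambda>\<omega>. norm (iexp (inner (X 1 \<omega>) u)))"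
    by (rule Bochner_Integration.integral_norm_bound)
  also have "\<dots> = 1" by (simp add: prob_space)
  finally show ?thesis by simp
qed

end

section \<open>The theorem on multivariate subordination\<close>

theorem theorem2p3:
  fixes M :: "'w measure"
    and H :: "'d::finite \<Rightarrow> 'h::{real_inner,polish_space} set"
    and L :: "'d \<Rightarrow> real \<Rightarrow> 'w \<Rightarrow> 'h"
    and \<phi> :: "'d \<Rightarrow> 'h \<Rightarrow> complex"
    and \<Theta> :: "real \<Rightarrow> 'w \<Rightarrow> real ^ 'd"
    and a :: "real ^ 'd"
    and F :: "(real ^ 'd) measure"
  assumes "prob_space M"
    and H: "\<And>j. subspace (H j)" "\<And>j. closed (H j)"
    and L_levy: "\<And>j. levy_process M (H j) (L j)"
    and L_cadlag: "\<And>j. cadlag M (L j)"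
    and L_exponent: "\<And>j. has_levy_exponent M (H j) (L j) (\<phi> j)"
    and L_indep: "prob_space.indep_vars M (\<lambda>_. trajectory_space) (\<lambda>j. trajectory (L j)) UNIV"
    and Theta_levy: "levy_process M UNIV \<Theta>"
    and Theta_cadlag: "cadlag M \<Theta>"
    and Theta_subordinator: "\<And>j. subordinator M (\<lambda>t \<omega>. \<Theta> t \<omega> $ j)"
    and Theta_triplet: "has_levy_khintchine_triplet M \<Theta> a 0 F"
    and F_concentrated: "AE \<theta> in F. \<theta> \<in> nonneg_orthant"
    and trunc_integrable: "set_integrable F nonneg_orthant trunc"
    and drift_nonneg: "drift0 a F \<in> nonneg_orthant"
    and L_Theta_indep: "prob_space.indep_processes M (\<lambda>t. multi_eval L (\<chi> j. t)) \<Theta>"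
  shows "levy_process M (hilbert_prod H) (\<lambda>t \<omega>. multi_eval L (\<Theta> t \<omega>) \<omega>) \<and>
    cadlag M (\<lambda>t \<omega>. multi_eval L (\<Theta> t \<omega>) \<omega>) \<and>
    has_levy_exponent M (hilbert_prod H) (\<lambda>t \<omega>. multi_eval L (\<Theta> t \<omega>) \<omega>)
      (\<lambda>u. subordinator_exponent a F (\<chi> j. \<phi> j (u $ j)))"
proof -
  interpret subordination M H L \<Theta>
    by (intro subordination.intro subordination_axioms.intro) fact+
  let ?\<psi> = "\<lambda>s. subordinator_exponent a F s"
  have F: "levy_measure F"
    using Theta_triplet by (simp add: has_levy_khintchine_triplet_def)
  have sets_F: "sets F = sets borel" using F by (simp add: levy_measure_def)
  have laplace: "expectation (\<lambda>\<omega>. exp (\<Sum>j\<in>UNIV. s $ j * of_real (\<Theta> t \<omega> $ j))) = exp (of_real t * ?\<psi> s)"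
    if t: "0 \<le> t" and s: "\<And>j. Re (s $ j) \<le> 0" for t s
  proof -
    define P where "P = distr M borel (\<Theta> t)"
    have Theta_t: "\<Theta> t \<in> borel_measurable M" by (rule Theta_measurable[OF t])
    interpret P: prob_space P
      unfolding P_def by (rule prob_space_distr[OF Theta_t])
    have P_integral: "(LINT x:nonneg_orthant|P. f x) = expectation (\<lambda>\<omega>. f (\<Theta> t \<omega>))"
      if f [measurable]: "f \<in> borel_measurable borel" for f :: "real ^ 'd \<Rightarrow> complex"
    proof -
      have "(LINT x:nonneg_orthant|P. f x)
          = expectation (\<lambda>\<omega>. indicat_real nonneg_orthant (\<Theta> t \<omega>) *\<^sub>R f (\<Theta> t \<omega>))"
        unfolding P_def set_lebesgue_integral_def by (rule integral_distr[OF Theta_t]) measurable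
      also have "\<dots> = expectation (\<lambda>\<omega>. f (\<Theta> t \<omega>))"
        using Theta_orthant[OF _ t] by (intro Bochner_Integration.integral_cong) auto
      finally show ?thesis .
    qed
    have "(LINT x:nonneg_orthant|P. iexp (inner x u)) = exp (of_real t * ?\<psi> (\<chi> j. \<i> * of_real (u $ j)))"
      for u :: "real ^ 'd"
    proof -
      have "(LINT x:nonneg_orthant|P. iexp (inner x u)) = expectation (\<lambda>\<omega>. iexp (inner (\<Theta> t \<omega>) u))"
        by (rule P_integral) measurable
      also have "\<dots> = exp (of_real t * ?\<psi> (\<chi> j. \<i> * of_real (u $ j)))"
        using Theta_triplet t
        unfolding has_levy_khintchine_triplet_def has_levy_exponent_def
          levy_khintchine_exponent_eq[OF F F_concentrated trunc_integrable, symmetric] by blast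
      finally show ?thesis .
    qed
    then have "(LINT x:nonneg_orthant|P. exp (\<Sum>j\<in>UNIV. s $ j * of_real (x $ j))) = exp (of_real t * ?\<psi> s)"
      unfolding subordinator_exponent_def
      by (intro laplace_transform_of_characteristic_function[OF _ _ sets_F
            levy_measure_integrable_min_norm[OF F trunc_integrable]] s)
         (simp_all add: P_def P.finite_measure_axioms[unfolded P_def])
    moreover have "(LINT x:nonneg_orthant|P. exp (\<Sum>j\<in>UNIV. s $ j * of_real (x $ j)))
        = expectation (\<lambda>\<omega>. exp (\<Sum>j\<in>UNIV. s $ j * of_real (\<Theta> t \<omega> $ j)))"
      by (rule P_integral) measurable
    ultimately show ?thesis by simp
  qed
  have "has_levy_exponent M (hilbert_prod H) subordinated (\<lambda>u. ?\<psi> (\<chi> j. \<phi> j (u $ j)))"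
    unfolding has_levy_exponent_def
  proof (intro allI impI ballI)
    fix t :: real and u assume t: "0 \<le> t" and u: "u \<in> hilbert_prod H"
    have "Re (\<phi> j (u $ j)) \<le> 0" for j
      using u by (intro Re_levy_exponent_nonpos[OF L_exponent]) (simp add: hilbert_prod_def)
    then show "expectation (\<lambda>\<omega>. iexp (inner (subordinated t \<omega>) u)) = exp (of_real t * ?\<psi> (\<chi> j. \<phi> j (u $ j)))"
      using laplace[OF t, of "\<chi> j. \<phi> j (u $ j)"] characteristic_function_subordinated[OF L_exponent u t] by simp
  qed
  then show ?thesis
    using levy_process_subordinated cadlag_subordinated by blast
qed

end
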